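(* Let $S$ be a regular symmetric operator in $\mathcal H$, let $z\in\widehat\rho(S)$ (i.e. $z$ is a point of regular type of $S$), and let $\widetilde S_z$ be the Shtraus extension of $S$. Then: (1) the operator $P_{\mathcal H_0}\widetilde S_z$ is closed; (2) the compression $P_{\mathcal H_0}\widetilde S_z\upharpoonright(\operatorname{dom}\widetilde S_z\cap\mathcal H_0)$ coincides with the Shtraus extension $(\widetilde{S_0})_z$ of $S_0$; (3) if $n'_+=0$ and $n'_->0$, then $\operatorname{dom}\widetilde S_z\subset\operatorname{dom}\widetilde S_z^*=\operatorname{dom}S^*$; (4) if $n'_+>0$ and $n'_-=0$, then $\operatorname{dom}\widetilde S_z^*\subset\operatorname{dom}\widetilde S_z=\operatorname{dom}S^*$; (5) if $S_0$ is selfadjoint in $\mathcal H_0$, then $\operatorname{dom}\widetilde S_z=\operatorname{dom}\widetilde S_z^*=\operatorname{dom}S^*$, the operator $(\widetilde S_z+\widetilde S_z^* )/2$ is selfadjoint and the operator $(\widetilde S_z-\widetilde S_z^* )/2i$ is bounded and essentially selfadjoint.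
   Context: $\mathcal H$ is an infinite-dimensional complex separable Hilbert space; $P_{\mathfrak K}$ is the orthogonal projection onto $\mathfrak K$; $\dot+$ is the direct sum of linear manifolds. $S$ is symmetric if $\operatorname{Im}(Sf,f)=0$ on $\operatorname{dom}S$. A number $\lambda\in\mathbb C$ is a point of regular type of $S$ if there is $k(\lambda)>0$ with $\|(S-\lambda I)f\|\ge k(\lambda)\|f\|$ for all $f\in\operatorname{dom}S$; $\widehat\rho(S)$ is the set of all such points (the field of regularity), and $\mathbb C\setminus\mathbb R\subseteq\widehat\rho(S)$ for closed symmetric $S$. For a closed non-densely defined symmetric $S$: $\mathcal H_0=\overline{\operatorname{dom}}\,S$, $\mathfrak L=\mathcal H\ominus\mathcal H_0$, $S_0=P_{\mathcal H_0}S$ (a densely defined symmetric operator in $\mathcal H_0$ with domain $\operatorname{dom}S$). $S$ is called regular if $S_0$ is closed. $S^*$ denotes the adjoint of $S$ regarded as a densely defined operator from $\mathcal H_0$ to $\mathcal H$; thus $S^*$ is an operator from $\mathcal H$ to $\mathcal H_0$. Put $\mathfrak N_\lambda=\mathcal H\ominus\operatorname{ran}(S-\bar\lambda I)$, $\mathfrak L_\lambda=P_{\mathfrak N_\lambda}\mathfrak L$, $\mathfrak N'_\lambda=\mathfrak N_\lambda\ominus\mathfrak L_\lambda=\mathfrak N_\lambda\cap\mathcal H_0$ (equal to $\mathcal H_0\ominus\operatorname{ran}(S_0-\bar\lambda I)$, the deficiency subspace of $S_0$ in $\mathcal H_0$), and $n'_\pm=\dim\mathfrak N'_\lambda$ for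 $\lambda$ in the open upper/lower half-plane $\mathbb C_\pm$ (semi-deficiency indices). For $z\in\widehat\rho(S)$ the Shtraus extension of $S$ is $\operatorname{dom}\widetilde S_z=\operatorname{dom}S\dot+\mathfrak N_z$, $\widetilde S_z(f_S+\varphi_z)=Sf_S+z\varphi_z$ ($f_S\in\operatorname{dom}S$, $\varphi_z\in\mathfrak N_z$); it is taken to be maximal dissipative for $z\in\mathbb C_+$, maximal accumulative for $z\in\mathbb C_-$, selfadjoint for $z\in\widehat\rho(S)\cap\mathbb R$, and $\widetilde S_z^*=\widetilde S_{\bar z}$. Likewise $\operatorname{dom}(\widetilde{S_0})_z=\operatorname{dom}S_0\dot+\mathfrak N'_z$, $(\widetilde{S_0})_z(f+\varphi'_z)=S_0f+z\varphi'_z$.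
   Formalization: Items (1) and (5) additionally assume that z is a point of regular type of S_0 (automatic for non-real z; they fail for other real z); items (3) and (4) assume z in the open upper half-plane (for z in the lower one the roles interchange, for real z they fail), with proper inclusions. *)

theory Defs
  imports "HOL-Analysis.Analysis" "HOL-Library.Extended_Nat"
begin

text \<open>
  Complex Hilbert spaces. The inner product is linear in its first argument; positivity and
  definiteness follow from \<open>norm_eq_sqrt_cinner\<close> and the norm axioms.
\<close>

class complex_hilbert = banach +
  fixes scaleC :: "complex \<Rightarrow> 'a \<Rightarrow> 'a"  (infixr "*\<^sub>C" 75)
    and cinner :: "'a \<Rightarrow> 'a \<Rightarrow> complex"
  assumes scaleC_add_right: "a *\<^sub>C (x + y) = a *\<^sub>C x + a *\<^sub>C y"
    and scaleC_add_left: "(a + b) *\<^sub>C x = a *\<^sub>C x + b *\<^sub>C x"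
    and scaleC_scaleC: "a *\<^sub>C (b *\<^sub>C x) = (a * b) *\<^sub>C x"
    and scaleR_scaleC: "r *\<^sub>R x = complex_of_real r *\<^sub>C x"
    and cinner_commute: "cinner x y = cnj (cinner y x)"
    and cinner_add_left: "cinner (x + y) w = cinner x w + cinner y w"
    and cinner_scaleC_left: "cinner (a *\<^sub>C x) y = a * cinner x y"
    and norm_eq_sqrt_cinner: "norm x = sqrt (Re (cinner x x))"

definition orth :: "'a::complex_hilbert set \<Rightarrow> 'a set"
  where "orth M = {x. \<forall>y\<in>M. cinner x y = 0}"

text \<open>The orthogonal projection; meaningful when \<open>K\<close> is a closed complex subspace.\<close>

definition proj :: "'a::complex_hilbert set \<Rightarrow> 'a \<Rightarrow> 'a"
  where "proj K x = (THE p. p \<in> K \<and> x - p \<in> orth K)"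

definition orthonormal :: "'a::complex_hilbert set \<Rightarrow> bool"
  where "orthonormal B \<longleftrightarrow> (\<forall>x\<in>B. \<forall>y\<in>B. cinner x y = (if x = y then 1 else 0))"

text \<open>
  Hilbert space dimension of a closed subspace. In a separable space orthonormal bases are
  countable, so that the only infinite dimension is \<open>\<infinity>\<close>.
\<close>

definition hdim :: "'a::complex_hilbert set \<Rightarrow> enat"
  where "hdim M = (SUP B \<in> {B. B \<subseteq> M \<and> finite B \<and> orthonormal B}. enat (card B))"

text \<open>
  An operator, defined on a linear manifold which need not be dense, is represented by its graph:
  \<open>(f, g) \<in> T\<close> means that \<open>f\<close> lies in the domain of \<open>T\<close> and \<open>T f = g\<close>. Thus
  \<open>Domain T\<close> is the domain, equality of sets is equality of operators including domains, and
  an operator is closed iff its graph is a closed set.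
\<close>

definition linear_operator :: "('a::complex_hilbert \<times> 'a) set \<Rightarrow> bool"
  where "linear_operator T \<longleftrightarrow>
    (0, 0) \<in> T \<and>
    (\<forall>f g f' g'. (f, g) \<in> T \<longrightarrow> (f', g') \<in> T \<longrightarrow> (f + f', g + g') \<in> T) \<and>
    (\<forall>c f g. (f, g) \<in> T \<longrightarrow> (c *\<^sub>C f, c *\<^sub>C g) \<in> T) \<and>
    single_valued T"

definition closed_operator :: "('a::complex_hilbert \<times> 'a) set \<Rightarrow> bool"
  where "closed_operator T \<longleftrightarrow> linear_operator T \<and> closed T"

definition bounded_operator :: "('a::complex_hilbert \<times> 'a) set \<Rightarrow> bool"
  where "bounded_operator T \<longleftrightarrow> linear_operator T \<and> (\<exists>c. \<forall>(f, g)\<in>T. norm g \<le> c * norm f)"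

definition op_plus :: "('a::complex_hilbert \<times> 'a) set \<Rightarrow> ('a \<times> 'a) set \<Rightarrow> ('a \<times> 'a) set"
  where "op_plus A B = {(f, g + h) | f g h. (f, g) \<in> A \<and> (f, h) \<in> B}"

definition op_minus :: "('a::complex_hilbert \<times> 'a) set \<Rightarrow> ('a \<times> 'a) set \<Rightarrow> ('a \<times> 'a) set"
  where "op_minus A B = {(f, g - h) | f g h. (f, g) \<in> A \<and> (f, h) \<in> B}"

definition op_scale :: "complex \<Rightarrow> ('a::complex_hilbert \<times> 'a) set \<Rightarrow> ('a \<times> 'a) set"
  where "op_scale c A = {(f, c *\<^sub>C g) | f g. (f, g) \<in> A}"

definition op_proj :: "'a::complex_hilbert set \<Rightarrow> ('a \<times> 'a) set \<Rightarrow> ('a \<times> 'a) set"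
  where "op_proj K T = {(f, proj K g) | f g. (f, g) \<in> T}"

definition op_restrict :: "('a::complex_hilbert \<times> 'a) set \<Rightarrow> 'a set \<Rightarrow> ('a \<times> 'a) set"
  where "op_restrict T D = {(f, g) \<in> T. f \<in> D}"

definition ran_shift :: "('a::complex_hilbert \<times> 'a) set \<Rightarrow> complex \<Rightarrow> 'a set"
  where "ran_shift T a = {g - a *\<^sub>C f | f g. (f, g) \<in> T}"

text \<open>
  The adjoint of \<open>T\<close> regarded as an operator from \<open>K\<close> to \<open>M\<close>, where \<open>T\<close> is densely defined in
  the closed subspace \<open>K\<close>; it acts from \<open>M\<close> to \<open>K\<close>.
\<close>

definition adjoint_on ::
    "'a::complex_hilbert set \<Rightarrow> 'a set \<Rightarrow> ('a \<times> 'a) set \<Rightarrow> ('a \<times> 'a) set"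
  where "adjoint_on K M T =
    {(g, h). g \<in> M \<and> h \<in> K \<and> (\<forall>(f, k)\<in>T. cinner k g = cinner f h)}"

abbreviation adjoint_op :: "('a::complex_hilbert \<times> 'a) set \<Rightarrow> ('a \<times> 'a) set"
  where "adjoint_op \<equiv> adjoint_on UNIV UNIV"

definition selfadjoint_in :: "'a::complex_hilbert set \<Rightarrow> ('a \<times> 'a) set \<Rightarrow> bool"
  where "selfadjoint_in K T \<longleftrightarrow>
    linear_operator T \<and> T \<subseteq> K \<times> K \<and> K \<subseteq> closure (Domain T) \<and> adjoint_on K K T = T"

definition essentially_selfadjoint_in :: "'a::complex_hilbert set \<Rightarrow> ('a \<times> 'a) set \<Rightarrow> bool"
  where "essentially_selfadjoint_in K T \<longleftrightarrow> linear_operator T \<and> selfadjoint_in K (closure T)"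

definition symmetric_operator :: "('a::complex_hilbert \<times> 'a) set \<Rightarrow> bool"
  where "symmetric_operator T \<longleftrightarrow> linear_operator T \<and> (\<forall>(f, g)\<in>T. Im (cinner g f) = 0)"

text \<open>The field of regularity.\<close>

definition regular_type_points :: "('a::complex_hilbert \<times> 'a) set \<Rightarrow> complex set"
  where "regular_type_points T =
    {a. \<exists>k>0. \<forall>(f, g)\<in>T. norm (g - a *\<^sub>C f) \<ge> k * norm f}"

text \<open>\<open>dom_space S\<close> is \<open>\<H>\<^sub>0\<close>, so that \<open>orth (dom_space S)\<close> is \<open>\<LL>\<close>.\<close>

definition dom_space :: "('a::complex_hilbert \<times> 'a) set \<Rightarrow> 'a set"
  where "dom_space S = closure (Domain S)"

definition compressed :: "('a::complex_hilbert \<times> 'a) set \<Rightarrow> ('a \<times> 'a) set"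
  where "compressed S = op_proj (dom_space S) S"

definition regular_symmetric :: "('a::complex_hilbert \<times> 'a) set \<Rightarrow> bool"
  where "regular_symmetric S \<longleftrightarrow>
    closed_operator S \<and> symmetric_operator S \<and> dom_space S \<noteq> UNIV \<and>
    closed_operator (compressed S)"

text \<open>The adjoint of \<open>S\<close> regarded as a densely defined operator from \<open>\<H>\<^sub>0\<close> to \<open>\<H>\<close>.\<close>

definition dom_adjoint :: "('a::complex_hilbert \<times> 'a) set \<Rightarrow> ('a \<times> 'a) set"
  where "dom_adjoint S = adjoint_on (dom_space S) UNIV S"

text \<open>The subspaces \<open>\<N>\<^sub>a\<close>, \<open>\<LL>\<^sub>a\<close> and \<open>\<N>'\<^sub>a = \<N>\<^sub>a \<ominus> \<LL>\<^sub>a\<close>.\<close>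

definition defect :: "('a::complex_hilbert \<times> 'a) set \<Rightarrow> complex \<Rightarrow> 'a set"
  where "defect S a = orth (ran_shift S (cnj a))"

definition defect_image :: "('a::complex_hilbert \<times> 'a) set \<Rightarrow> complex \<Rightarrow> 'a set"
  where "defect_image S a = proj (defect S a) ` orth (dom_space S)"

definition semi_defect :: "('a::complex_hilbert \<times> 'a) set \<Rightarrow> complex \<Rightarrow> 'a set"
  where "semi_defect S a = defect S a \<inter> orth (defect_image S a)"

text \<open>
  The semi-deficiency indices \<open>n'\<^sub>+\<close> and \<open>n'\<^sub>-\<close> are the values of \<open>semi_deficiency_index S\<close>
  at points of the open upper and lower half-plane (they do not depend on the points).
\<close>

definition semi_deficiency_index :: "('a::complex_hilbert \<times> 'a) set \<Rightarrow> complex \<Rightarrow> enat"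
  where "semi_deficiency_index S a = hdim (semi_defect S a)"

text \<open>
  The map \<open>f + \<phi> \<mapsto> T f + z \<phi>\<close> for \<open>f\<close> in the domain of \<open>T\<close> and \<open>\<phi> \<in> N\<close>, as a graph. It is
  single-valued when the sum of \<open>Domain T\<close> and \<open>N\<close> is direct.
\<close>

definition extend_by ::
    "('a::complex_hilbert \<times> 'a) set \<Rightarrow> 'a set \<Rightarrow> complex \<Rightarrow> ('a \<times> 'a) set"
  where "extend_by T N z = {(f + \<phi>, g + z *\<^sub>C \<phi>) | f g \<phi>. (f, g) \<in> T \<and> \<phi> \<in> N}"

text \<open>The Shtraus extensions of \<open>S\<close> in \<open>\<H>\<close> and of \<open>S\<^sub>0\<close> in \<open>\<H>\<^sub>0\<close>.\<close>

definition shtraus :: "('a::complex_hilbert \<times> 'a) set \<Rightarrow> complex \<Rightarrow> ('a \<times> 'a) set"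
  where "shtraus S z = extend_by S (defect S z) z"

definition shtraus_compressed :: "('a::complex_hilbert \<times> 'a) set \<Rightarrow> complex \<Rightarrow> ('a \<times> 'a) set"
  where "shtraus_compressed S z = extend_by (compressed S) (semi_defect S z) z"

end

theory Submission imports Defs begin

text \<open>
  Since \<open>S\<close> is regular, the closed graph theorem bounds \<open>S\<close> relative to \<open>S\<^sub>0\<close>. On the Shtraus
  extension, \<open>P\<^bsub>H0\<^esub> S\<^sub>z - z P\<^bsub>H0\<^esub>\<close> only sees the component in \<open>dom S\<close>, where it acts as the
  injective operator \<open>S\<^sub>0 - z\<close> with closed range; this gives (1). When the deficiency
  subspace of \<open>S\<^sub>0\<close> at \<open>z\<close> vanishes, \<open>S\<^sub>0 - cnj z\<close> is onto \<open>H0\<close>, and solving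
  \<open>(S\<^sub>0 - cnj z) f = S\<^sup>* x - cnj z P\<^bsub>H0\<^esub> x\<close> splits every \<open>x\<close> in \<open>dom S\<^sup>*\<close> as \<open>f\<close> plus a defect vector
  at \<open>cnj z\<close>; this gives (3) and (4). If \<open>S\<^sub>0\<close> is selfadjoint, then both extensions have domain
  \<open>dom S\<^sup>*\<close> and the same projection \<open>S\<^sup>*\<close> onto \<open>H0\<close>; their difference is controlled by the
  \<open>H0\<close>-orthogonal component of the argument, so the imaginary part is bounded and the real part
  is a bounded perturbation of an operator with known adjoint.
\<close>

section \<open>Complex Hilbert spaces\<close>

text \<open>The delicate point is the real axis. Regular type for \<open>S\<close> bounds
  \<open>g - z *\<^sub>C f\<close> from below, but projecting onto the closure of the domain may
  destroy this bound: at real \<open>z\<close> there can be \<open>f \<noteq> 0\<close> in the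
  domain with \<open>S f - z f\<close> nonzero and orthogonal to that closure. Such an
  \<open>f\<close> also lies in the defect subspace, so that the graph \<open>shtraus S z\<close>
  has two values over \<open>f\<close>. Whatever needs a genuine operator therefore asks for regular
  type with respect to \<open>S0\<close>, which off the real axis follows from symmetry. The formula
  for the adjoint is an identity of graphs and rests on regular type for \<open>S\<close>. The
  semi-deficiency indices are given at arbitrary points \<open>u\<close> and \<open>v\<close>, while
  the argument concerns \<open>z\<close> and \<open>cnj z\<close>. Only whether an index vanishes
  matters, so it is enough to carry triviality of the deficiency subspaces across a
  half-plane.\<close>

lemma cinner_scaleR_left: "cinner (r *\<^sub>R x) y = of_real r * cinner x y"
  by (simp add: scaleR_scaleC cinner_scaleC_left)

lemma cinner_add_right: "cinner w (x + y) = cinner w x + cinner w y"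
  by (metis cinner_add_left cinner_commute complex_cnj_add)

lemma cinner_scaleC_right: "cinner x (a *\<^sub>C y) = cnj a * cinner x y"
  by (metis cinner_commute cinner_scaleC_left complex_cnj_mult)

lemma cinner_scaleR_right: "cinner x (r *\<^sub>R y) = of_real r * cinner x y"
  by (simp add: scaleR_scaleC cinner_scaleC_right)

lemma Im_cinner_self [simp]: "Im (cinner x x) = 0"
  using arg_cong[OF cinner_commute[of x x], of Im] by simp

text \<open>\<open>sqrt\<close> is negative on negative reals, so nonnegativity of the norm already
  forces the real part of \<open>cinner x x\<close> to be nonnegative.\<close>

lemma cinner_self: "cinner x x = of_real ((norm x)\<^sup>2)"
proof -
  have "0 \<le> Re (cinner x x)"
    by (metis norm_eq_sqrt_cinner norm_ge_zero real_sqrt_ge_0_iff)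
  then show ?thesis
    by (simp add: complex_eq_iff norm_eq_sqrt_cinner[of x])
qed

lemma norm_scaleC: "norm (a *\<^sub>C x) = cmod a * norm (x::'a::complex_hilbert)"
proof -
  have "complex_of_real ((norm (a *\<^sub>C x))\<^sup>2) = of_real ((cmod a * norm x)\<^sup>2)"
    unfolding cinner_self[of "a *\<^sub>C x", symmetric] cinner_scaleC_left cinner_scaleC_right
      cinner_self[of x] power_mult_distrib of_real_mult complex_norm_square
    by simp
  then have "(norm (a *\<^sub>C x))\<^sup>2 = (cmod a * norm x)\<^sup>2"
    using of_real_eq_iff by blast
  then show ?thesis
    by (simp add: power2_eq_iff_nonneg)
qed

lemma cinner_norm_le: "cmod (cinner x y) \<le> norm x * norm (y::'a::complex_hilbert)"
proof (cases "y = 0")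
  case True
  have "cinner x 0 = 0"
    using cinner_scaleR_right[of x 0 0] by simp
  then show ?thesis using True by simp
next
  case False
  define c where "c = cinner x y"
  \<comment> \<open>\<open>t\<close> is the coefficient of \<open>x\<close> along \<open>y\<close>;
    the Cauchy-Schwarz inequality is then \<open>0 \<le> (norm w)\<^sup>2\<close> for the remainder
    \<open>w\<close>.\<close>
  define t where "t = c / of_real ((norm y)\<^sup>2)"
  define w where "w = x + (- t) *\<^sub>C y"
  have ny: "norm y > 0" using False by simp
  have yx: "cinner y x = cnj c"
    unfolding c_def by (rule cinner_commute)
  have tn: "t * of_real ((norm y)\<^sup>2) = c"
    using ny by (simp add: t_def)
  have "cinner w w = of_real ((norm x)\<^sup>2) - cnj t * c - t * cnj c + cnj t * (t * of_real ((norm y)\<^sup>2))"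
    unfolding w_def cinner_add_left cinner_add_right cinner_scaleC_left cinner_scaleC_right
      cinner_self[of x] cinner_self[of y] yx c_def[symmetric] complex_cnj_minus
    by (simp add: algebra_simps)
  also have "\<dots> = of_real ((norm x)\<^sup>2) - t * cnj c"
    unfolding tn by simp
  also have "t * cnj c = of_real ((cmod c)\<^sup>2 / (norm y)\<^sup>2)"
    by (simp only: t_def of_real_divide complex_norm_square times_divide_eq_left)
  also have "of_real ((norm x)\<^sup>2) - \<dots> = complex_of_real ((norm x)\<^sup>2 - (cmod c)\<^sup>2 / (norm y)\<^sup>2)"
    by simp
  finally have "(norm w)\<^sup>2 = (norm x)\<^sup>2 - (cmod c)\<^sup>2 / (norm y)\<^sup>2"
    unfolding cinner_self using of_real_eq_iff by blast
  then have "(cmod c)\<^sup>2 / (norm y)\<^sup>2 \<le> (norm x)\<^sup>2"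
    by (smt (verit) zero_le_power2)
  then have "(cmod c)\<^sup>2 \<le> (norm x * norm y)\<^sup>2"
    using ny by (simp add: field_simps power_mult_distrib)
  then show ?thesis
    unfolding c_def by (rule power2_le_imp_le) simp
qed

text \<open>The form is conjugate-linear in its second argument, hence real bilinear, with
  Cauchy-Schwarz as the bound. The interpretation then delivers differences, negation, continuity
  and limits.\<close>

lemma bounded_bilinear_cinner: "bounded_bilinear cinner"
  by (rule bounded_bilinear.intro)
    (auto simp: cinner_add_left cinner_add_right cinner_scaleR_left cinner_scaleR_right
      scaleR_conv_of_real intro!: exI[of _ 1] cinner_norm_le)

interpretation cinner: bounded_bilinear cinner
  by (rule bounded_bilinear_cinner)

lemma bounded_bilinear_scaleC:
  "bounded_bilinear (scaleC :: complex \<Rightarrow> 'a \<Rightarrow> 'a::complex_hilbert)"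
  by (rule bounded_bilinear.intro)
    (auto simp: scaleC_add_left scaleC_add_right scaleR_scaleC scaleC_scaleC norm_scaleC
      mult.commute scaleR_conv_of_real intro!: exI[of _ 1])

interpretation scaleC: bounded_bilinear scaleC
  by (rule bounded_bilinear_scaleC)

declare cinner.zero_left [simp] cinner.zero_right [simp]
  scaleC.zero_left [simp] scaleC.zero_right [simp]

lemma scaleC_one [simp]: "1 *\<^sub>C x = x"
  using scaleR_scaleC[of 1 x] by simp

lemma scaleC_minus_one [simp]: "(- 1) *\<^sub>C x = - x"
  by (simp add: scaleC.minus_left)

lemmas cinner_simps = cinner_add_left cinner_add_right cinner.diff_left cinner.diff_right
  cinner_scaleC_left cinner_scaleC_right cinner.minus_left cinner.minus_right

lemma cinner_eq_zero_iff [simp]: "cinner x x = 0 \<longleftrightarrow> x = 0"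
  by (simp add: cinner_self)

lemma cinner_eq_zero_commute: "cinner x y = 0 \<longleftrightarrow> cinner y x = 0"
  by (metis cinner_commute complex_cnj_zero)

lemma norm_diff_square:
  "(norm (x - y))\<^sup>2 = (norm x)\<^sup>2 + (norm (y::'a::complex_hilbert))\<^sup>2 - 2 * Re (cinner x y)"
proof -
  have "(norm (x - y))\<^sup>2 = Re (cinner (x - y) (x - y))"
    by (simp add: cinner_self)
  also have "\<dots> = (norm x)\<^sup>2 + (norm y)\<^sup>2 - 2 * Re (cinner x y)"
    using arg_cong[OF cinner_commute[of y x], of Re]
    by (simp add: cinner.diff_left cinner.diff_right cinner_self[of x] cinner_self[of y])
  finally show ?thesis .
qed

lemma parallelogram:
  "(norm (x + y))\<^sup>2 + (norm (x - y))\<^sup>2 = 2 * (norm x)\<^sup>2 + 2 * (norm (y::'a::complex_hilbert))\<^sup>2"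
  using norm_diff_square[of x y] norm_diff_square[of x "- y"]
  by (simp add: cinner.minus_right)

section \<open>Complex subspaces and orthogonal complements\<close>

definition csubspace :: "'a::complex_hilbert set \<Rightarrow> bool"
  where "csubspace M \<longleftrightarrow> 0 \<in> M \<and> (\<forall>x\<in>M. \<forall>y\<in>M. x + y \<in> M) \<and> (\<forall>c. \<forall>x\<in>M. c *\<^sub>C x \<in> M)"

lemma csubspaceD:
  assumes "csubspace M"
  shows csubspace_0: "0 \<in> M"
    and csubspace_add: "\<lbrakk>x \<in> M; y \<in> M\<rbrakk> \<Longrightarrow> x + y \<in> M"
    and csubspace_scaleC: "x \<in> M \<Longrightarrow> c *\<^sub>C x \<in> M"
    and csubspace_diff: "\<lbrakk>x \<in> M; y \<in> M\<rbrakk> \<Longrightarrow> x - y \<in> M"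
proof -
  show "0 \<in> M" "\<lbrakk>x \<in> M; y \<in> M\<rbrakk> \<Longrightarrow> x + y \<in> M" "x \<in> M \<Longrightarrow> c *\<^sub>C x \<in> M"
    using assms by (auto simp: csubspace_def)
  show "\<lbrakk>x \<in> M; y \<in> M\<rbrakk> \<Longrightarrow> x - y \<in> M"
    using assms unfolding csubspace_def
    by (metis add_uminus_conv_diff scaleC_minus_one)
qed

lemma csubspace_Int: "\<lbrakk>csubspace M; csubspace N\<rbrakk> \<Longrightarrow> csubspace (M \<inter> N)"
  by (auto simp: csubspace_def)

lemma csubspace_orth: "csubspace (orth M)"
  by (auto simp: csubspace_def orth_def cinner_simps)

lemma closed_orth: "closed (orth M)"
proof -
  have "orth M = (\<Inter>y\<in>M. {x. cinner x y = 0})"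
    by (auto simp: orth_def)
  moreover have "closed {x. cinner x y = 0}" for y :: 'a
    by (intro closed_Collect_eq continuous_intros cinner.continuous_on)
  ultimately show ?thesis by auto
qed

lemma csubspace_closure: assumes "csubspace M" shows "csubspace (closure M)"
  unfolding csubspace_def
proof (intro conjI ballI allI)
  show "0 \<in> closure M"
    using assms closure_subset by (auto simp: csubspace_def)
next
  fix x y assume "x \<in> closure M" "y \<in> closure M"
  then obtain f g where "\<And>n::nat. f n \<in> M" "f \<longlonglongrightarrow> x" "\<And>n::nat. g n \<in> M" "g \<longlonglongrightarrow> y"
    by (auto simp: closure_sequential)
  then show "x + y \<in> closure M"
    unfolding closure_sequential
    by (intro exI[of _ "\<lambda>n. f n + g n"]) (auto intro: tendsto_intros csubspace_add[OF assms])
next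
  fix c x assume "x \<in> closure M"
  then obtain f where "\<And>n::nat. f n \<in> M" "f \<longlonglongrightarrow> x"
    by (auto simp: closure_sequential)
  then show "c *\<^sub>C x \<in> closure M"
    unfolding closure_sequential
    by (intro exI[of _ "\<lambda>n. c *\<^sub>C f n"])
      (auto intro: scaleC.tendsto tendsto_const csubspace_scaleC[OF assms])
qed

lemma orth_closure [simp]: "orth (closure M) = orth M"
proof
  show "orth (closure M) \<subseteq> orth M"
    using closure_subset by (fastforce simp: orth_def)
  show "orth M \<subseteq> orth (closure M)"
  proof
    fix x assume x: "x \<in> orth M"
    have "closed {y. cinner x y = 0}"
      by (intro closed_Collect_eq continuous_intros cinner.continuous_on)
    moreover have "M \<subseteq> {y. cinner x y = 0}"
      using x by (auto simp: orth_def)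
    ultimately show "x \<in> orth (closure M)"
      using closure_minimal[of M "{y. cinner x y = 0}"] by (auto simp: orth_def)
  qed
qed

subsection \<open>Orthogonal projections\<close>

lemma nearest_point_exists:
  fixes K :: "'a::complex_hilbert set"
  assumes K: "csubspace K" "closed K"
  obtains p where "p \<in> K" "\<And>q. q \<in> K \<Longrightarrow> norm (x - p) \<le> norm (x - q)"
proof -
  define d where "d = infdist x K"
  have ne: "K \<noteq> {}" using K csubspace_0 by blast
  have dle: "d \<le> norm (x - q)" if "q \<in> K" for q
    using infdist_le[OF that, of x] by (simp add: d_def dist_norm)
  have d0: "0 \<le> d" by (simp add: d_def infdist_nonneg)
  have "\<exists>q\<in>K. norm (x - q) < d + inverse (real (Suc n))" for n
  proof -
    have "infdist x K < d + inverse (real (Suc n))" by (simp add: d_def)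
    then show ?thesis
      using cInf_lessD[of "dist x ` K"] ne
      by (auto simp: infdist_notempty dist_norm)
  qed
  then obtain q where q: "\<And>n. q n \<in> K" "\<And>n. norm (x - q n) < d + inverse (real (Suc n))"
    by metis
  have lim: "(\<lambda>n. norm (x - q n)) \<longlonglongrightarrow> d"
  proof (rule tendsto_sandwich[where f = "\<lambda>_. d"])
    show "(\<lambda>n. d + inverse (real (Suc n))) \<longlonglongrightarrow> d"
      using tendsto_add[OF tendsto_const[of d] LIMSEQ_inverse_real_of_nat] by simp
    show "\<forall>\<^sub>F n in sequentially. norm (x - q n) \<le> d + inverse (real (Suc n))"
      using q(2) by (intro always_eventually allI less_imp_le)
  qed (use q dle in auto)
  \<comment> \<open>Parallelogram law together with the midpoint, which lies in \<open>K\<close> and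
    so has distance at least \<open>d\<close> from \<open>x\<close>; this makes the minimising
    sequence Cauchy.\<close>
  have est: "(norm (q m - q n))\<^sup>2 \<le> 2 * (norm (x - q m))\<^sup>2 + 2 * (norm (x - q n))\<^sup>2 - 4 * d\<^sup>2" for m n
  proof -
    let ?mid = "(1/2) *\<^sub>R (q m + q n)"
    have "?mid \<in> K"
      unfolding scaleR_scaleC using K q by (intro csubspace_scaleC csubspace_add)
    then have "d \<le> norm (x - ?mid)" by (rule dle)
    then have "d\<^sup>2 \<le> (norm (x - ?mid))\<^sup>2" using d0 by (simp add: power_mono)
    moreover have "(x - q m) + (x - q n) = 2 *\<^sub>R (x - ?mid)"
      by (simp add: algebra_simps scaleR_2)
    then have "(norm ((x - q m) + (x - q n)))\<^sup>2 = 4 * (norm (x - ?mid))\<^sup>2"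
      by (simp add: power_mult_distrib)
    moreover have "norm ((x - q m) - (x - q n)) = norm (q m - q n)"
      by (simp add: norm_minus_commute)
    ultimately show ?thesis
      using parallelogram[of "x - q m" "x - q n"] by simp
  qed
  have "Cauchy q"
  proof (rule metric_CauchyI)
    fix e :: real assume e: "e > 0"
    have "(\<lambda>n. 4 * (norm (x - q n))\<^sup>2 - 4 * d\<^sup>2) \<longlonglongrightarrow> 4 * d\<^sup>2 - 4 * d\<^sup>2"
      by (intro tendsto_intros lim)
    then have "\<forall>\<^sub>F n in sequentially. 4 * (norm (x - q n))\<^sup>2 - 4 * d\<^sup>2 < e\<^sup>2"
      using e by (auto dest!: order_tendstoD(2)[where a = "e\<^sup>2"])
    then obtain N where N: "\<And>n. n \<ge> N \<Longrightarrow> 4 * (norm (x - q n))\<^sup>2 - 4 * d\<^sup>2 < e\<^sup>2"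
      by (auto simp: eventually_sequentially)
    show "\<exists>M. \<forall>m\<ge>M. \<forall>n\<ge>M. dist (q m) (q n) < e"
    proof (intro exI allI impI)
      fix m n assume "m \<ge> N" "n \<ge> N"
      then have "(norm (q m - q n))\<^sup>2 < e\<^sup>2"
        using est[of m n] N[of m] N[of n] by linarith
      then show "dist (q m) (q n) < e"
        using e by (simp add: dist_norm power2_less_imp_less)
    qed
  qed
  then obtain p where p: "q \<longlonglongrightarrow> p"
    using Cauchy_convergent convergent_def by blast
  have "p \<in> K"
    using K(2) q(1) p closed_sequentially by blast
  moreover have "norm (x - p) = d"
    using LIMSEQ_unique[OF tendsto_norm[OF tendsto_diff[OF tendsto_const p]] lim] .
  ultimately show thesis using that dle by blast
qed

lemma proj_exists:
  fixes K :: "'a::complex_hilbert set"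
  assumes K: "csubspace K" "closed K"
  obtains p where "p \<in> K" "x - p \<in> orth K"
proof -
  obtain p where p: "p \<in> K" and min: "\<And>q. q \<in> K \<Longrightarrow> norm (x - p) \<le> norm (x - q)"
    using nearest_point_exists[OF K] by blast
  have "cinner (x - p) k = 0" if k: "k \<in> K" for k
  proof (cases "k = 0")
    case False
    define c where "c = cinner (x - p) k"
    \<comment> \<open>This \<open>t\<close> makes \<open>p + t *\<^sub>C k\<close> the best
      approximation on the line through \<open>p\<close>; minimality of \<open>p\<close> against
      that point leaves no room for \<open>c \<noteq> 0\<close>.\<close>
    define t where "t = c / of_real ((norm k)\<^sup>2)"
    have "p + t *\<^sub>C k \<in> K"
      using K p k by (intro csubspace_add csubspace_scaleC)
    then have "norm (x - p) \<le> norm (x - p - t *\<^sub>C k)"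
      using min by (metis diff_diff_eq)
    then have "(norm (x - p))\<^sup>2 \<le> (norm (x - p - t *\<^sub>C k))\<^sup>2"
      by (simp add: power_mono)
    then have "2 * Re (cnj t * c) \<le> (cmod t * norm k)\<^sup>2"
      by (simp add: norm_diff_square norm_scaleC cinner_scaleC_right c_def)
    moreover have "cnj t * c = of_real ((cmod c)\<^sup>2 / (norm k)\<^sup>2)"
      by (simp only: t_def of_real_divide complex_norm_square) simp
    moreover have "(cmod t * norm k)\<^sup>2 = (cmod c)\<^sup>2 / (norm k)\<^sup>2"
      using False
      by (simp add: t_def norm_divide power_divide power2_eq_square norm_mult)
    ultimately have "(cmod c)\<^sup>2 / (norm k)\<^sup>2 \<le> 0"
      by simp
    then show ?thesis
      using False by (simp add: divide_le_0_iff c_def)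
  qed simp
  then show thesis
    using that p by (auto simp: orth_def)
qed

lemma orth_Int_self: "x \<in> K \<Longrightarrow> x \<in> orth K \<Longrightarrow> x = 0"
  by (auto simp: orth_def)

text \<open>Two candidates differ by a vector of \<open>K\<close> orthogonal to \<open>K\<close>.
  Values of projections are exhibited and checked by this rule, so the definite description is
  unfolded only here.\<close>

lemma proj_eqI:
  assumes K: "csubspace K" "p \<in> K" "x - p \<in> orth K"
  shows "proj K x = p"
  unfolding proj_def
proof (rule the_equality)
  fix q assume q: "q \<in> K \<and> x - q \<in> orth K"
  have "(x - p) - (x - q) \<in> orth K"
    using K q csubspace_diff[OF csubspace_orth] by blast
  moreover have "q - p \<in> K" using K q csubspace_diff by blast
  ultimately show "q = p"
    using orth_Int_self[of "q - p" K] by simp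
qed (use K in auto)

lemma proj_mem:
  assumes K: "csubspace K" "closed K"
  shows proj_in: "proj K x \<in> K" and proj_orth: "x - proj K x \<in> orth K"
proof -
  obtain p where "p \<in> K" "x - p \<in> orth K" using proj_exists[OF K] by blast
  then show "proj K x \<in> K" "x - proj K x \<in> orth K"
    using proj_eqI[OF K(1)] by auto
qed

lemma cinner_proj:
  assumes K: "csubspace K" "closed K" and h: "h \<in> K"
  shows "cinner (proj K x) h = cinner x h" and "cinner h (proj K x) = cinner h x"
proof -
  have "cinner (x - proj K x) h = 0" using proj_orth[OF K] h by (auto simp: orth_def)
  then show "cinner (proj K x) h = cinner x h" by (simp add: cinner.diff_left)
  then show "cinner h (proj K x) = cinner h x" by (metis cinner_commute)
qed

lemma proj_linear:
  assumes K: "csubspace K" "closed K"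
  shows proj_add: "proj K (x + y) = proj K x + proj K y"
    and proj_diff: "proj K (x - y) = proj K x - proj K y"
    and proj_scaleC: "proj K (c *\<^sub>C x) = c *\<^sub>C proj K x"
proof -
  note mem = proj_in[OF K] proj_orth[OF K]
  have "(x + y) - (proj K x + proj K y) \<in> orth K"
    using csubspace_add[OF csubspace_orth mem(2) mem(2), of x y] by (simp add: add_diff_add)
  then show "proj K (x + y) = proj K x + proj K y"
    by (intro proj_eqI K(1) csubspace_add[OF K(1)] mem)
  have "(x - y) - (proj K x - proj K y) \<in> orth K"
    using csubspace_diff[OF csubspace_orth mem(2) mem(2), of x y] by (simp add: algebra_simps)
  then show "proj K (x - y) = proj K x - proj K y"
    by (intro proj_eqI K(1) csubspace_diff[OF K(1)] mem)
  have "c *\<^sub>C x - c *\<^sub>C proj K x \<in> orth K"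
    using csubspace_scaleC[OF csubspace_orth mem(2), of c x] by (simp add: scaleC.diff_right)
  then show "proj K (c *\<^sub>C x) = c *\<^sub>C proj K x"
    by (intro proj_eqI K(1) csubspace_scaleC[OF K(1)] mem)
qed

lemma proj_id: "csubspace K \<Longrightarrow> h \<in> K \<Longrightarrow> proj K h = h"
  by (rule proj_eqI) (auto intro: csubspace_0 csubspace_orth)

lemma norm_proj_pythagoras:
  assumes K: "csubspace K" "closed K"
  shows "(norm x)\<^sup>2 = (norm (proj K x))\<^sup>2 + (norm (x - proj K x))\<^sup>2"
proof -
  have "cinner x (proj K x) = cinner (proj K x) (proj K x)"
    using cinner_proj(1)[OF K proj_in[OF K]] by simp
  then show ?thesis
    using norm_diff_square[of x "proj K x"] by (simp add: cinner_self)
qed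

lemma norm_proj_le:
  assumes K: "csubspace K" "closed K"
  shows "norm (proj K x) \<le> norm x" and "norm (x - proj K x) \<le> norm x"
proof -
  have "(norm (proj K x))\<^sup>2 \<le> (norm x)\<^sup>2" "(norm (x - proj K x))\<^sup>2 \<le> (norm x)\<^sup>2"
    by (simp_all add: norm_proj_pythagoras[OF K, of x])
  then show "norm (proj K x) \<le> norm x" "norm (x - proj K x) \<le> norm x"
    by (auto intro: power2_le_imp_le)
qed

lemma tendsto_proj:
  assumes K: "csubspace K" "closed K" and F: "(F \<longlongrightarrow> x) G"
  shows "((\<lambda>n. proj K (F n)) \<longlongrightarrow> proj K x) G"
proof -
  have "((\<lambda>n. F n - x) \<longlongrightarrow> 0) G" using F by (simp add: LIM_zero)
  then have "((\<lambda>n. proj K (F n) - proj K x) \<longlongrightarrow> 0) G"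
    by (rule Lim_transform_bound[rotated])
      (simp add: norm_proj_le[OF K] flip: proj_diff[OF K])
  then show ?thesis by (rule LIM_zero_cancel)
qed

lemma orth_orth:
  assumes K: "csubspace K" "closed K"
  shows "orth (orth K) = K"
proof
  show "K \<subseteq> orth (orth K)"
    using cinner_eq_zero_commute by (fastforce simp: orth_def)
  show "orth (orth K) \<subseteq> K"
  proof
    fix x assume x: "x \<in> orth (orth K)"
    have "proj K x \<in> orth (orth K)"
      using proj_in[OF K] \<open>K \<subseteq> orth (orth K)\<close> by blast
    then have "x - proj K x \<in> orth (orth K)"
      using x csubspace_diff[OF csubspace_orth] by blast
    then have "x - proj K x = 0"
      using proj_orth[OF K] orth_Int_self by blast
    then show "x \<in> K" using proj_in[OF K, of x] by simp
  qed
qed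

lemma closure_eq_UNIV_if_orth_trivial:
  assumes "csubspace M" "\<And>x. x \<in> orth M \<Longrightarrow> x = 0"
  shows "closure M = UNIV"
proof -
  have "orth (orth (closure M)) = closure M"
    by (intro orth_orth csubspace_closure assms closed_closure)
  moreover have "orth (closure M) \<subseteq> {0}" using assms(2) by auto
  then have "orth (orth (closure M)) = UNIV" by (fastforce simp: orth_def[of "orth _"])
  ultimately show ?thesis by simp
qed

lemma csubspace_eq_if_orth_trivial:
  assumes M: "csubspace M" "closed M" "M \<subseteq> K" and K: "csubspace K"
    and orth: "K \<inter> orth M \<subseteq> {0}"
  shows "M = K"
proof
  show "K \<subseteq> M"
  proof
    fix x assume "x \<in> K"
    then have "x - proj M x \<in> K"
      using proj_in[OF M(1,2)] M(3) csubspace_diff[OF K] by blast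
    then show "x \<in> M"
      using orth proj_orth[OF M(1,2)] proj_in[OF M(1,2), of x] by fastforce
  qed
qed (rule M(3))

lemma eq_zero_if_orth_dense: "closure M = UNIV \<Longrightarrow> (\<And>y. y \<in> M \<Longrightarrow> cinner x y = 0) \<Longrightarrow> x = 0"
  using orth_closure[of M] orth_Int_self[of x UNIV] by (auto simp: orth_def)

text \<open>A nonzero vector normalises to a one-element orthonormal set, and the zero space
  contains only the empty one. The semi-deficiency indices are evaluated through this test.\<close>

lemma hdim_eq_0_iff:
  assumes M: "csubspace M"
  shows "hdim M = 0 \<longleftrightarrow> M = {0}"
proof
  assume h: "hdim M = 0"
  show "M = {0}"
  proof (rule ccontr)
    assume "M \<noteq> {0}"
    then obtain x where x: "x \<in> M" "x \<noteq> 0" using csubspace_0[OF M] by blast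
    define e where "e = complex_of_real (inverse (norm x)) *\<^sub>C x"
    have "e \<in> M" using x M by (simp add: e_def csubspace_scaleC)
    moreover have "cinner e e = 1"
      using x by (simp add: e_def cinner_scaleC_left cinner_scaleC_right cinner_self[of x]
          power2_eq_square field_simps)
    ultimately have "{e} \<in> {B. B \<subseteq> M \<and> finite B \<and> orthonormal B}"
      by (simp add: orthonormal_def)
    then have "enat (card {e}) \<le> hdim M"
      unfolding hdim_def by (rule SUP_upper)
    then show False using h by (simp add: enat_0_iff)
  qed
next
  assume M0: "M = {0}"
  have "B = {}" if "B \<subseteq> M" "orthonormal B" for B
    using that M0 by (auto simp: orthonormal_def subset_singleton_iff)
  then have "enat (card B) \<le> 0" if "B \<in> {B. B \<subseteq> M \<and> finite B \<and> orthonormal B}" for B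
    using that by (auto simp: zero_enat_def)
  then have "hdim M \<le> 0"
    unfolding hdim_def by (rule SUP_least)
  then show "hdim M = 0" by simp
qed

section \<open>The closed graph theorem\<close>

text \<open>Baire's theorem gives approximate solutions of bounded norm; completeness turns them into
  exact ones by summing a geometric series of corrections.\<close>

theorem closed_graph_bound:
  fixes R :: "('a::banach \<times> 'b::banach) set"
  assumes cl: "closed R" and sub: "subspace R" and sv: "single_valued R"
    and clD: "closed (Domain R)"
  obtains C where "C \<ge> 0" "\<And>x y. (x, y) \<in> R \<Longrightarrow> norm y \<le> C * norm x"
proof -
  define K where "K = Domain R"
  have Radd: "(x + x', y + y') \<in> R" if "(x, y) \<in> R" "(x', y') \<in> R" for x x' y y'
    using subspace_add[OF sub that] by simp
  have Rdiff: "(x - x', y - y') \<in> R" if "(x, y) \<in> R" "(x', y') \<in> R" for x x' y y'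
    using subspace_diff[OF sub that] by simp
  have Rscale: "(c *\<^sub>R x, c *\<^sub>R y) \<in> R" if "(x, y) \<in> R" for c x y
    using subspace_scale[OF sub that, of c] by simp
  have R0: "(0, 0) \<in> R"
    using subspace_0[OF sub] by (simp add: zero_prod_def)
  \<comment> \<open>The sets for Baire's theorem, which is applied inside the closed, hence
    complete, domain and not in the whole space.\<close>
  define E where "E c = {x. \<exists>y. (x, y) \<in> R \<and> norm y \<le> c}" for c :: real
  have EK: "E c \<subseteq> K" for c by (auto simp: E_def K_def)
  have Escale: "t *\<^sub>R x \<in> E (\<bar>t\<bar> * c)" if "x \<in> E c" for t c x
    using that Rscale unfolding E_def by (fastforce intro: mult_left_mono)
  have Ediff: "x - x' \<in> E (c + c')" if xx: "x \<in> E c" "x' \<in> E c'" for x x' c c'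
  proof -
    obtain y y' where "(x, y) \<in> R" "norm y \<le> c" "(x', y') \<in> R" "norm y' \<le> c'"
      using xx by (auto simp: E_def)
    then show ?thesis
      unfolding E_def using Rdiff norm_triangle_ineq4[of y y'] by fastforce
  qed
  have cover: "K = (\<Union>n. E (real n))"
  proof
    show "K \<subseteq> (\<Union>n. E (real n))"
    proof
      fix x assume "x \<in> K"
      then obtain y where "(x, y) \<in> R" by (auto simp: K_def)
      then show "x \<in> (\<Union>n. E (real n))"
        using real_arch_simple[of "norm y"] by (auto simp: E_def)
    qed
  qed (use EK in auto)
  let ?X = "top_of_set K"
  have clK: "closed K" using clD by (simp add: K_def)
  have "?X interior_of (\<Union> (range (\<lambda>n. closure (E (real n))))) \<noteq> {}"
  proof -
    have "K \<subseteq> (\<Union> (range (\<lambda>n. closure (E (real n)))))"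
      using cover closure_subset by fast
    moreover have "0 \<in> K" using R0 by (auto simp: K_def)
    ultimately have "0 \<in> ?X interior_of (\<Union> (range (\<lambda>n. closure (E (real n)))))"
      unfolding interior_of_def by (auto intro!: exI[of _ K])
    then show ?thesis by blast
  qed
  moreover have "completely_metrizable_space ?X"
    using clK closed_closedin completely_metrizable_space_closedin
      completely_metrizable_space_euclidean by blast
  ultimately have "\<exists>T\<in>range (\<lambda>n. closure (E (real n))). \<not> (closedin ?X T \<and> ?X interior_of T = {})"
    using Baire_category_alt[of ?X "range (\<lambda>n. closure (E (real n)))"] by auto
  moreover have "closedin ?X (closure (E (real n)))" for n
    by (metis EK clK closed_closure closed_subset closure_minimal)
  ultimately obtain n where "?X interior_of (closure (E (real n))) \<noteq> {}"
    by auto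
  then obtain x0 U where "openin ?X U" "x0 \<in> U" "U \<subseteq> closure (E (real n))"
    unfolding interior_of_def by auto
  then obtain r where r: "r > 0" "ball x0 r \<inter> K \<subseteq> closure (E (real n))" and x0: "x0 \<in> K"
    by (metis Int_commute openin_contains_ball openin_subset subset_trans topspace_euclidean_subtopology subsetD)
  \<comment> \<open>With \<open>t = r / (2 * norm x)\<close> as chosen below, \<open>1 / t\<close>
    times \<open>2 * real n\<close> equals \<open>4 * real n * norm x / r\<close>; the added
    \<open>1\<close> keeps \<open>c\<close> positive when \<open>n = 0\<close>.\<close>
  define c where "c = 4 * (real n + 1) / r"
  have c0: "c > 0" using r by (simp add: c_def)
  have approx: "\<exists>x'\<in>E (c * norm x). norm (x - x') \<le> norm x / 2" if xK: "x \<in> K" for x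
  proof (cases "x = 0")
    case True
    then show ?thesis using R0 by (auto simp: E_def)
  next
    case False
    define t where "t = r / (2 * norm x)"
    have t: "t > 0" using False r by (simp add: t_def)
    have "t *\<^sub>R x \<in> K" using xK Rscale by (fastforce simp: K_def)
    then have "x0 + t *\<^sub>R x \<in> K" using x0 Radd by (fastforce simp: K_def)
    moreover have "norm (t *\<^sub>R x) < r" using False r by (simp add: t_def)
    then have "x0 + t *\<^sub>R x \<in> ball x0 r"
      by (simp add: dist_norm)
    ultimately have 1: "x0 + t *\<^sub>R x \<in> closure (E (real n))" using r by blast
    have 2: "x0 \<in> closure (E (real n))" using r x0 by (meson IntI centre_in_ball subsetD)
    \<comment> \<open>Two approximation errors below \<open>e\<close>, rescaled by
      \<open>1 / t\<close>, add up to at most \<open>norm x / 2\<close>.\<close>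
    define e where "e = t * norm x / 4"
    have e: "e > 0" using t False by (simp add: e_def)
    obtain a b where ab: "a \<in> E (real n)" "norm (a - (x0 + t *\<^sub>R x)) < e"
        "b \<in> E (real n)" "norm (b - x0) < e"
      using 1 2 e unfolding closure_approachable dist_norm by blast
    define x' where "x' = (1 / t) *\<^sub>R (a - b)"
    have "x' \<in> E (\<bar>1 / t\<bar> * (real n + real n))"
      unfolding x'_def by (intro Escale Ediff ab)
    moreover have "\<bar>1 / t\<bar> * (real n + real n) \<le> c * norm x"
      using t False r by (simp add: t_def c_def field_simps)
    ultimately have "x' \<in> E (c * norm x)"
      unfolding E_def by (blast intro: order_trans)
    moreover have "norm (x - x') \<le> norm x / 2"
    proof -
      have "x - x' = (1 / t) *\<^sub>R ((b - x0) - (a - (x0 + t *\<^sub>R x)))"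
        using t by (simp add: x'_def algebra_simps)
      then have "norm (x - x') = norm ((b - x0) - (a - (x0 + t *\<^sub>R x))) / t"
        using t by simp
      also have "\<dots> \<le> (e + e) / t"
        using ab t norm_triangle_ineq4[of "b - x0" "a - (x0 + t *\<^sub>R x)"]
        by (intro divide_right_mono) auto
      also have "\<dots> = norm x / 2" using t by (simp add: e_def)
      finally show ?thesis .
    qed
    ultimately show ?thesis by blast
  qed
  have "\<exists>p. (p \<in> R \<and> norm (snd p) \<le> c * norm x \<and> norm (x - fst p) \<le> norm x / 2)" if "x \<in> K" for x
    using approx[OF that] by (auto simp: E_def)
  then obtain G where G: "\<And>x. x \<in> K \<Longrightarrow> G x \<in> R"
      "\<And>x. x \<in> K \<Longrightarrow> norm (snd (G x)) \<le> c * norm x"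
      "\<And>x. x \<in> K \<Longrightarrow> norm (x - fst (G x)) \<le> norm x / 2"
    by metis
  have bound: "norm y \<le> 2 * c * norm x" if xy: "(x, y) \<in> R" for x y
  proof -
    \<comment> \<open>\<open>X k\<close> is what remains of \<open>x\<close> after \<open>k\<close>
      corrections by \<open>G\<close>; each correction at least halves its norm.\<close>
    define X where "X = rec_nat x (\<lambda>_ v. v - fst (G v))"
    have X0: "X 0 = x" and XS: "X (Suc k) = X k - fst (G (X k))" for k
      by (simp_all add: X_def)
    have XK: "X k \<in> K" for k
    proof (induction k)
      case 0
      then show ?case using xy by (auto simp: X0 K_def)
    next
      case (Suc k)
      then obtain y' where "(X k, y') \<in> R" by (auto simp: K_def)
      moreover have "(fst (G (X k)), snd (G (X k))) \<in> R" using G(1)[OF Suc] by simp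
      ultimately show ?case unfolding XS K_def using Rdiff by (metis Domain.DomainI)
    qed
    have Xn: "norm (X k) \<le> norm x * (1/2) ^ k" for k
    proof (induction k)
      case (Suc k)
      then show ?case using G(3)[OF XK[of k]] by (simp add: XS)
    qed (simp add: X0)
    define Y where "Y k = snd (G (X k))" for k
    have Yn: "norm (Y k) \<le> c * norm x * (1/2) ^ k" for k
    proof -
      have "norm (Y k) \<le> c * norm (X k)" using G(2)[OF XK] by (simp add: Y_def)
      also have "\<dots> \<le> c * (norm x * (1/2) ^ k)" using Xn c0 by (intro mult_left_mono) auto
      finally show ?thesis by simp
    qed
    have geo: "(\<lambda>k. c * norm x * (1/2) ^ k) sums (c * norm x * 2)"
      using sums_mult[OF geometric_sums[of "1/2::real"]] by simp
    have sY: "summable (\<lambda>k. norm (Y k))"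
      by (rule summable_comparison_test'[OF sums_summable[OF geo], of 0]) (simp add: Yn)
    have nY: "norm (\<Sum>k. Y k) \<le> c * norm x * 2"
    proof -
      have "norm (\<Sum>k. Y k) \<le> (\<Sum>k. norm (Y k))" by (rule summable_norm[OF sY])
      also have "\<dots> \<le> (\<Sum>k. c * norm x * (1/2) ^ k)"
        by (intro suminf_le Yn sY sums_summable[OF geo])
      finally show ?thesis using sums_unique[OF geo] by simp
    qed
    have part: "(x - X k, \<Sum>i<k. Y i) \<in> R" for k
    proof (induction k)
      case (Suc k)
      have "(fst (G (X k)), Y k) \<in> R" using G(1)[OF XK] by (simp add: Y_def)
      from Radd[OF Suc this] show ?case by (simp add: XS algebra_simps)
    qed (simp add: X0 R0)
    have "X \<longlonglongrightarrow> 0"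
    proof (rule Lim_null_comparison)
      show "(\<lambda>k. norm x * (1/2) ^ k) \<longlonglongrightarrow> 0"
        by (intro tendsto_mult_right_zero LIMSEQ_realpow_zero) auto
    qed (simp add: Xn)
    then have "(\<lambda>k. (x - X k, \<Sum>i<k. Y i)) \<longlonglongrightarrow> (x - 0, \<Sum>k. Y k)"
      by (intro tendsto_intros summable_LIMSEQ summable_norm_cancel[OF sY])
    then have "(x, \<Sum>k. Y k) \<in> R"
      using closed_sequentially[OF cl] part by (metis (lifting) diff_zero)
    then have "y = (\<Sum>k. Y k)" using sv xy by (auto dest: single_valuedD)
    then show ?thesis using nY by (simp add: mult_ac)
  qed
  show thesis
    by (rule that[of "2 * c"]) (use c0 bound in auto)
qed

section \<open>Operators as graphs\<close>

lemma linear_operatorD: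
  assumes "linear_operator T"
  shows linear_operator_0: "(0, 0) \<in> T"
    and linear_operator_add: "\<lbrakk>(f, g) \<in> T; (f', g') \<in> T\<rbrakk> \<Longrightarrow> (f + f', g + g') \<in> T"
    and linear_operator_scaleC: "(f, g) \<in> T \<Longrightarrow> (c *\<^sub>C f, c *\<^sub>C g) \<in> T"
    and linear_operator_diff: "\<lbrakk>(f, g) \<in> T; (f', g') \<in> T\<rbrakk> \<Longrightarrow> (f - f', g - g') \<in> T"
    and linear_operator_unique: "\<lbrakk>(f, g) \<in> T; (f, g') \<in> T\<rbrakk> \<Longrightarrow> g = g'"
proof -
  show add: "(f + f', g + g') \<in> T" if "(f, g) \<in> T" "(f', g') \<in> T" for f g f' g'
    using assms that by (auto simp: linear_operator_def)
  show scale: "(c *\<^sub>C f, c *\<^sub>C g) \<in> T" if "(f, g) \<in> T" for c f g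
    using assms that by (auto simp: linear_operator_def)
  show "(0, 0) \<in> T" "\<lbrakk>(f, g) \<in> T; (f, g') \<in> T\<rbrakk> \<Longrightarrow> g = g'"
    using assms by (auto simp: linear_operator_def dest: single_valuedD)
  show "(f - f', g - g') \<in> T" if "(f, g) \<in> T" "(f', g') \<in> T"
    using add[OF that(1) scale[OF that(2), of "- 1"]] by simp
qed

lemma linear_operatorI:
  assumes "(0, 0) \<in> T"
    and add: "\<And>f g f' g'. (f, g) \<in> T \<Longrightarrow> (f', g') \<in> T \<Longrightarrow> (f + f', g + g') \<in> T"
    and scale: "\<And>c f g. (f, g) \<in> T \<Longrightarrow> (c *\<^sub>C f, c *\<^sub>C g) \<in> T"
    and zero: "\<And>g. (0, g) \<in> T \<Longrightarrow> g = 0"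
  shows "linear_operator T"
proof -
  have "g = g'" if "(f, g) \<in> T" "(f, g') \<in> T" for f g g'
    using zero[of "g - g'"] add[OF that(1) scale[OF that(2), of "- 1"]] by simp
  then show ?thesis
    using assms by (auto simp: linear_operator_def intro!: single_valuedI)
qed

lemma csubspace_Domain: "linear_operator T \<Longrightarrow> csubspace (Domain T)"
  unfolding csubspace_def
  by (blast intro: linear_operator_0 linear_operator_add linear_operator_scaleC)

lemma op_plusI: "\<lbrakk>(f, g) \<in> A; (f, h) \<in> B\<rbrakk> \<Longrightarrow> (f, g + h) \<in> op_plus A B"
  and op_scaleI: "(f, g) \<in> A \<Longrightarrow> (f, c *\<^sub>C g) \<in> op_scale c A"
  and extend_byI: "\<lbrakk>(f, g) \<in> T; \<phi> \<in> N\<rbrakk> \<Longrightarrow> (f + \<phi>, g + z *\<^sub>C \<phi>) \<in> extend_by T N z"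
  and ran_shiftI: "(f, g) \<in> T \<Longrightarrow> g - a *\<^sub>C f \<in> ran_shift T a"
  by (auto simp: op_plus_def op_scale_def extend_by_def ran_shift_def)

lemma linear_op_plus:
  assumes A: "linear_operator A" and B: "linear_operator B"
  shows "linear_operator (op_plus A B)"
proof (rule linear_operatorI)
  show "(0, 0) \<in> op_plus A B"
    using linear_operator_0[OF A] linear_operator_0[OF B] by (force simp: op_plus_def)
next
  fix f g f' g' assume "(f, g) \<in> op_plus A B" "(f', g') \<in> op_plus A B"
  then obtain a b a' b' where "g = a + b" "g' = a' + b'"
    "(f, a) \<in> A" "(f, b) \<in> B" "(f', a') \<in> A" "(f', b') \<in> B"
    by (auto simp: op_plus_def)
  then show "(f + f', g + g') \<in> op_plus A B"
    using op_plusI[OF linear_operator_add[OF A] linear_operator_add[OF B], of f a f' a' b b']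
    by (simp add: algebra_simps)
next
  fix c f g assume "(f, g) \<in> op_plus A B"
  then obtain a b where "g = a + b" "(f, a) \<in> A" "(f, b) \<in> B"
    by (auto simp: op_plus_def)
  then show "(c *\<^sub>C f, c *\<^sub>C g) \<in> op_plus A B"
    by (auto simp: scaleC_add_right intro!: op_plusI linear_operator_scaleC A B)
next
  fix g assume "(0, g) \<in> op_plus A B"
  then show "g = 0"
    using linear_operator_unique[OF A _ linear_operator_0[OF A]]
      linear_operator_unique[OF B _ linear_operator_0[OF B]]
    by (fastforce simp: op_plus_def)
qed

lemma linear_op_scale:
  assumes A: "linear_operator A"
  shows "linear_operator (op_scale c A)"
proof (rule linear_operatorI)
  show "(0, 0) \<in> op_scale c A"
    using linear_operator_0[OF A] by (force simp: op_scale_def)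
next
  fix f g f' g' assume "(f, g) \<in> op_scale c A" "(f', g') \<in> op_scale c A"
  then obtain a a' where "g = c *\<^sub>C a" "g' = c *\<^sub>C a'" "(f, a) \<in> A" "(f', a') \<in> A"
    by (auto simp: op_scale_def)
  then show "(f + f', g + g') \<in> op_scale c A"
    by (auto simp flip: scaleC_add_right intro!: op_scaleI linear_operator_add A)
next
  fix d f g assume "(f, g) \<in> op_scale c A"
  then obtain a where "g = c *\<^sub>C a" "(f, a) \<in> A"
    by (auto simp: op_scale_def)
  then show "(d *\<^sub>C f, d *\<^sub>C g) \<in> op_scale c A"
    using op_scaleI[OF linear_operator_scaleC[OF A], of f a d c]
    by (simp add: scaleC_scaleC mult.commute)
next
  fix g assume "(0, g) \<in> op_scale c A"
  then show "g = 0"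
    using linear_operator_unique[OF A _ linear_operator_0[OF A]]
    by (fastforce simp: op_scale_def)
qed

lemma op_minus_conv_plus: "op_minus A B = op_plus A (op_scale (- 1) B)"
proof -
  have "(f, g) \<in> op_minus A B \<longleftrightarrow> (f, g) \<in> op_plus A (op_scale (- 1) B)" for f g
    unfolding op_minus_def op_plus_def op_scale_def
    by (auto simp del: scaleC_minus_one) (metis scaleC_minus_one add_uminus_conv_diff)+
  then show ?thesis by auto
qed

lemma linear_op_minus:
  "\<lbrakk>linear_operator A; linear_operator B\<rbrakk> \<Longrightarrow> linear_operator (op_minus A B)"
  unfolding op_minus_conv_plus by (intro linear_op_plus linear_op_scale)

lemma linear_extend_by:
  assumes T: "linear_operator T" and N: "csubspace N" and dir: "Domain T \<inter> N \<subseteq> {0}"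
  shows "linear_operator (extend_by T N z)"
proof (rule linear_operatorI)
  show "(0, 0) \<in> extend_by T N z"
    using linear_operator_0[OF T] csubspace_0[OF N] by (force simp: extend_by_def)
next
  fix f g f' g' assume "(f, g) \<in> extend_by T N z" "(f', g') \<in> extend_by T N z"
  then obtain a b \<phi> a' b' \<phi>' where
    "f = a + \<phi>" "g = b + z *\<^sub>C \<phi>" "(a, b) \<in> T" "\<phi> \<in> N"
    "f' = a' + \<phi>'" "g' = b' + z *\<^sub>C \<phi>'" "(a', b') \<in> T" "\<phi>' \<in> N"
    by (auto simp: extend_by_def)
  then show "(f + f', g + g') \<in> extend_by T N z"
    using extend_byI[OF linear_operator_add[OF T] csubspace_add[OF N], of a b a' b' \<phi> \<phi>' z]
    by (simp add: scaleC_add_right algebra_simps)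
next
  fix c f g assume "(f, g) \<in> extend_by T N z"
  then obtain a b \<phi> where "f = a + \<phi>" "g = b + z *\<^sub>C \<phi>" "(a, b) \<in> T" "\<phi> \<in> N"
    by (auto simp: extend_by_def)
  then show "(c *\<^sub>C f, c *\<^sub>C g) \<in> extend_by T N z"
    using extend_byI[OF linear_operator_scaleC[OF T] csubspace_scaleC[OF N], of a b \<phi> c c z]
    by (simp add: scaleC_add_right scaleC_scaleC mult.commute)
next
  fix g assume "(0, g) \<in> extend_by T N z"
  then obtain a b \<phi> where ab: "0 = a + \<phi>" "g = b + z *\<^sub>C \<phi>" "(a, b) \<in> T" "\<phi> \<in> N"
    by (auto simp: extend_by_def)
  \<comment> \<open>Directness of the sum enters here: \<open>a\<close> is a multiple of
    \<open>\<phi>\<close> and so lies in both summands.\<close>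
  then have "a = (- 1) *\<^sub>C \<phi>" by (simp add: eq_neg_iff_add_eq_0)
  then have "a \<in> N" using csubspace_scaleC[OF N ab(4), of "- 1"] by simp
  then have "a = 0" using ab dir by auto
  then show "g = 0"
    using ab linear_operator_unique[OF T _ linear_operator_0[OF T]] by auto
qed

section \<open>Points of regular type, defect subspaces and the adjoint of the Shtraus
  extension\<close>

lemma csubspace_ran_shift:
  assumes T: "linear_operator T"
  shows "csubspace (ran_shift T a)"
  unfolding csubspace_def
proof (intro conjI ballI allI)
  show "0 \<in> ran_shift T a"
    using ran_shiftI[OF linear_operator_0[OF T], of a] by simp
next
  fix x y assume "x \<in> ran_shift T a" "y \<in> ran_shift T a"
  then obtain f g f' g' where "x = g - a *\<^sub>C f" "y = g' - a *\<^sub>C f'" "(f, g) \<in> T" "(f', g') \<in> T"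
    by (auto simp: ran_shift_def)
  then show "x + y \<in> ran_shift T a"
    using ran_shiftI[OF linear_operator_add[OF T], of f g f' g' a]
    by (simp add: scaleC_add_right add_diff_add)
next
  fix c x assume "x \<in> ran_shift T a"
  then obtain f g where "x = g - a *\<^sub>C f" "(f, g) \<in> T"
    by (auto simp: ran_shift_def)
  then show "c *\<^sub>C x \<in> ran_shift T a"
    using ran_shiftI[OF linear_operator_scaleC[OF T], of f g c a]
    by (simp add: scaleC.diff_right scaleC_scaleC mult.commute)
qed

text \<open>The lower bound at \<open>a\<close> makes \<open>F\<close> Cauchy as soon as the shifted
  values are, and the closed graph contains the limit. Closedness of shifted ranges, of the
  projected extension and of the auxiliary graph in \<open>S_bounded_by_S0\<close> all come from
  this.\<close>

lemma convergent_if_shift_convergent: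
  assumes T: "closed_operator T" and a: "a \<in> regular_type_points T"
    and FG: "\<And>n. (F n, G n) \<in> T" and lim: "(\<lambda>n. G n - a *\<^sub>C F n) \<longlonglongrightarrow> y"
  obtains f where "F \<longlonglongrightarrow> f" "G \<longlonglongrightarrow> y + a *\<^sub>C f" "(f, y + a *\<^sub>C f) \<in> T"
proof -
  obtain k where k: "k > 0" "\<And>f g. (f, g) \<in> T \<Longrightarrow> k * norm f \<le> norm (g - a *\<^sub>C f)"
    using a by (auto simp: regular_type_points_def)
  have lin: "linear_operator T" using T by (simp add: closed_operator_def)
  have "Cauchy F"
  proof (rule metric_CauchyI)
    fix e :: real assume e: "e > 0"
    then have "k * e > 0" using k by simp
    moreover have "Cauchy (\<lambda>n. G n - a *\<^sub>C F n)" using lim LIMSEQ_imp_Cauchy by blast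
    ultimately obtain M where M: "\<And>m n. m \<ge> M \<Longrightarrow> n \<ge> M \<Longrightarrow>
        dist (G m - a *\<^sub>C F m) (G n - a *\<^sub>C F n) < k * e"
      using metric_CauchyD by blast
    show "\<exists>M. \<forall>m\<ge>M. \<forall>n\<ge>M. dist (F m) (F n) < e"
    proof (intro exI allI impI)
      fix m n assume mn: "m \<ge> M" "n \<ge> M"
      have "k * norm (F m - F n) \<le> norm ((G m - G n) - a *\<^sub>C (F m - F n))"
        by (rule k(2)) (rule linear_operator_diff[OF lin FG FG])
      also have "(G m - G n) - a *\<^sub>C (F m - F n) = (G m - a *\<^sub>C F m) - (G n - a *\<^sub>C F n)"
        by (simp add: scaleC.diff_right)
      also have "norm \<dots> < k * e" using M[OF mn] by (simp add: dist_norm)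
      finally show "dist (F m) (F n) < e" using k by (simp add: dist_norm)
    qed
  qed
  then obtain f where f: "F \<longlonglongrightarrow> f"
    using Cauchy_convergent convergent_def by blast
  have "(\<lambda>n. (G n - a *\<^sub>C F n) + a *\<^sub>C F n) \<longlonglongrightarrow> y + a *\<^sub>C f"
    by (intro tendsto_intros lim scaleC.tendsto f)
  then have G: "G \<longlonglongrightarrow> y + a *\<^sub>C f" by simp
  have "(\<lambda>n. (F n, G n)) \<longlonglongrightarrow> (f, y + a *\<^sub>C f)"
    by (intro tendsto_intros f G)
  then have "(f, y + a *\<^sub>C f) \<in> T"
    using closed_sequentially[of T "\<lambda>n. (F n, G n)"] T FG by (simp add: closed_operator_def)
  then show thesis using that f G by blast
qed

lemma closed_ran_shift:
  assumes T: "closed_operator T" and a: "a \<in> regular_type_points T"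
  shows "closed (ran_shift T a)"
  unfolding closed_sequential_limits
proof (intro allI impI)
  fix X y assume X: "(\<forall>n. X n \<in> ran_shift T a) \<and> X \<longlonglongrightarrow> y"
  then have "\<exists>p. p \<in> T \<and> X n = snd p - a *\<^sub>C fst p" for n
    unfolding ran_shift_def by fastforce
  then obtain p where p: "\<And>n. p n \<in> T" "\<And>n. X n = snd (p n) - a *\<^sub>C fst (p n)"
    by metis
  have "(\<lambda>n. snd (p n) - a *\<^sub>C fst (p n)) \<longlonglongrightarrow> y"
    using X by (simp flip: p(2))
  then obtain f where "(f, y + a *\<^sub>C f) \<in> T"
    using convergent_if_shift_convergent[OF T a, of "\<lambda>n. fst (p n)" "\<lambda>n. snd (p n)" y] p(1)
    by (metis prod.collapse)
  then show "y \<in> ran_shift T a"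
    using ran_shiftI[of f "y + a *\<^sub>C f" T a] by simp
qed

text \<open>Polarisation: reality of the form at \<open>f + f'\<close> settles the imaginary parts,
  reality at \<open>f + \<i> *\<^sub>C f'\<close> the real parts.\<close>

lemma symmetric_operator_cinner:
  assumes T: "symmetric_operator T" and fg: "(f, g) \<in> T" "(f', g') \<in> T"
  shows "cinner g f' = cinner f g'"
proof -
  have lin: "linear_operator T" and real: "\<And>f g. (f, g) \<in> T \<Longrightarrow> Im (cinner g f) = 0"
    using T by (auto simp: symmetric_operator_def)
  have "Im (cinner (g + g') (f + f')) = 0"
    by (rule real) (rule linear_operator_add[OF lin fg])
  then have 1: "Im (cinner g f' + cinner g' f) = 0"
    using real[OF fg(1)] real[OF fg(2)] by (simp add: cinner_simps)
  have "Im (cinner (g + \<i> *\<^sub>C g') (f + \<i> *\<^sub>C f')) = 0"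
    by (rule real) (intro linear_operator_add[OF lin] linear_operator_scaleC[OF lin] fg)
  then have 2: "Re (cinner g f') = Re (cinner g' f)"
    using real[OF fg(1)] real[OF fg(2)] by (simp add: cinner_simps)
  have "cinner g f' = cnj (cinner g' f)"
    using 1 2 by (simp add: complex_eq_iff)
  then show ?thesis by (metis cinner_commute)
qed

text \<open>Since the form of \<open>T\<close> is real, pairing \<open>g - a *\<^sub>C f\<close>
  with \<open>f\<close> leaves the imaginary part \<open>- Im a * (norm f)\<^sup>2\<close>; so
  \<open>\<bar>Im a\<bar>\<close> serves as the constant.\<close>

lemma nonreal_regular_type:
  assumes T: "symmetric_operator T" and a: "Im a \<noteq> 0"
  shows "a \<in> regular_type_points T"
proof -
  have "\<bar>Im a\<bar> * norm f \<le> norm (g - a *\<^sub>C f)" if fg: "(f, g) \<in> T" for f g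
  proof (cases "f = 0")
    case False
    have "Im (cinner (g - a *\<^sub>C f) f) = - Im a * (norm f)\<^sup>2"
      using T fg by (auto simp: symmetric_operator_def cinner_simps cinner_self)
    then have "\<bar>Im a\<bar> * (norm f)\<^sup>2 = \<bar>Im (cinner (g - a *\<^sub>C f) f)\<bar>"
      by (simp add: abs_mult)
    also have "\<dots> \<le> norm (g - a *\<^sub>C f) * norm f"
      using abs_Im_le_cmod cinner_norm_le order_trans by blast
    finally show ?thesis using False by (simp add: power2_eq_square)
  qed simp
  then show ?thesis
    unfolding regular_type_points_def using a by (auto intro!: exI[of _ "\<bar>Im a\<bar>"])
qed

lemma regular_type_cnj:
  assumes T: "symmetric_operator T" and a: "a \<in> regular_type_points T"
  shows "cnj a \<in> regular_type_points T"
proof (cases "Im a = 0")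
  case True
  then have "cnj a = a" by (simp add: complex_eq_iff)
  then show ?thesis using a by simp
qed (auto intro: nonreal_regular_type[OF T])

text \<open>Weak form of the statement that the adjoint of \<open>S\<close> sends
  \<open>\<phi>\<close> to \<open>a\<close> times the projection of \<open>\<phi>\<close> onto the
  closure of the domain.\<close>

lemma mem_defect_iff:
  "\<phi> \<in> defect S a \<longleftrightarrow> (\<forall>f g. (f, g) \<in> S \<longrightarrow> cinner g \<phi> = cnj a * cinner f \<phi>)"
proof -
  have "cinner \<phi> (g - cnj a *\<^sub>C f) = 0 \<longleftrightarrow> cinner g \<phi> = cnj a * cinner f \<phi>" for f g
    by (subst cinner_eq_zero_commute) (simp add: cinner_simps)
  note * = this
  have "\<phi> \<in> defect S a \<longleftrightarrow> (\<forall>f g. (f, g) \<in> S \<longrightarrow> cinner \<phi> (g - cnj a *\<^sub>C f) = 0)"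
    unfolding defect_def orth_def ran_shift_def by blast
  then show ?thesis unfolding * .
qed

lemma csubspace_defect: "csubspace (defect S a)" and closed_defect: "closed (defect S a)"
  by (auto simp: defect_def csubspace_orth closed_orth)

text \<open>For the harder inclusion, testing against the defect subspace at \<open>z\<close> puts
  \<open>y - cnj z *\<^sub>C x\<close> into its orthogonal complement. This is the closed range of
  \<open>S - cnj z\<close>, which supplies \<open>f\<close>; testing against \<open>S\<close> then
  makes \<open>x - f\<close> a defect vector at \<open>cnj z\<close>.\<close>

lemma adjoint_shtraus:
  assumes S: "closed_operator S" "symmetric_operator S" and z: "z \<in> regular_type_points S"
  shows "adjoint_op (shtraus S z) = shtraus S (cnj z)"
proof
  have lin: "linear_operator S" using S(1) by (simp add: closed_operator_def)
  note symm = symmetric_operator_cinner[OF S(2)]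
  show "shtraus S (cnj z) \<subseteq> adjoint_op (shtraus S z)"
  proof clarify
    fix x y assume "(x, y) \<in> shtraus S (cnj z)"
    then obtain f g \<psi> where x: "x = f + \<psi>" "y = g + cnj z *\<^sub>C \<psi>" "(f, g) \<in> S"
        "\<psi> \<in> defect S (cnj z)"
      by (auto simp: shtraus_def extend_by_def)
    have "cinner (g' + z *\<^sub>C \<phi>) x = cinner (f' + \<phi>) y"
      if h: "(f', g') \<in> S" "\<phi> \<in> defect S z" for f' g' \<phi>
    proof -
      have "cinner g' f = cinner f' g" by (rule symm[OF h(1) x(3)])
      moreover have "cinner g' \<psi> = z * cinner f' \<psi>"
        using x(4) h(1) by (simp add: mem_defect_iff)
      moreover have "cinner g \<phi> = cnj z * cinner f \<phi>"
        using x(3) h(2) by (simp add: mem_defect_iff)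
      then have "cinner \<phi> g = z * cinner \<phi> f"
        using cinner_commute[of \<phi> g] cinner_commute[of \<phi> f] by simp
      ultimately show ?thesis using x(1,2) by (simp add: cinner_simps algebra_simps)
    qed
    then show "(x, y) \<in> adjoint_op (shtraus S z)"
      unfolding adjoint_on_def shtraus_def extend_by_def by auto
  qed
  show "adjoint_op (shtraus S z) \<subseteq> shtraus S (cnj z)"
  proof clarify
    fix x y assume "(x, y) \<in> adjoint_op (shtraus S z)"
    then have "cinner (g + z *\<^sub>C \<phi>) x = cinner (f + \<phi>) y"
      if "(f, g) \<in> S" "\<phi> \<in> defect S z" for f g \<phi>
      using that unfolding adjoint_on_def shtraus_def extend_by_def by blast
    note * = this
    have adjS: "cinner g x = cinner f y" if "(f, g) \<in> S" for f g
      using *[OF that csubspace_0[OF csubspace_defect]] by simp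
    have adjN: "z * cinner \<phi> x = cinner \<phi> y" if "\<phi> \<in> defect S z" for \<phi>
      using *[OF linear_operator_0[OF lin] that] by (simp add: cinner_scaleC_left)
    have "cinner (y - cnj z *\<^sub>C x) \<phi> = 0" if "\<phi> \<in> defect S z" for \<phi>
      using adjN[OF that] by (subst cinner_eq_zero_commute) (simp add: cinner_simps)
    then have "y - cnj z *\<^sub>C x \<in> orth (defect S z)" by (simp add: orth_def)
    also have "orth (defect S z) = ran_shift S (cnj z)"
      unfolding defect_def
      by (intro orth_orth csubspace_ran_shift lin closed_ran_shift S regular_type_cnj z)
    finally obtain f g where fg: "(f, g) \<in> S" "y - cnj z *\<^sub>C x = g - cnj z *\<^sub>C f"
      by (auto simp: ran_shift_def)
    have y: "y = g + cnj z *\<^sub>C (x - f)"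
      using fg(2) by (simp add: scaleC.diff_right algebra_simps)
    have "x - f \<in> defect S (cnj z)"
      unfolding mem_defect_iff
    proof (intro allI impI)
      fix f' g' assume h: "(f', g') \<in> S"
      have "cinner g' (x - f) = cinner f' y - cinner f' g"
        using adjS[OF h] symm[OF h fg(1)] by (simp add: cinner_simps)
      also have "\<dots> = cinner f' (cnj z *\<^sub>C (x - f))" using y by (simp add: cinner_simps)
      finally show "cinner g' (x - f) = cnj (cnj z) * cinner f' (x - f)"
        by (simp add: cinner_scaleC_right)
    qed
    then show "(x, y) \<in> shtraus S (cnj z)"
      using extend_byI[OF fg(1), of "x - f" _ "cnj z"] y unfolding shtraus_def by simp
  qed
qed

section \<open>Real and imaginary parts of an operator with bounded imaginary part\<close>

lemma bounded_densely_defined_extends: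
  assumes T: "bounded_operator T" and dense: "closure (Domain T) = UNIV"
  shows "\<exists>y. (x, y) \<in> closure T"
proof -
  have lin: "linear_operator T" using T by (simp add: bounded_operator_def)
  obtain c where c: "\<And>f g. (f, g) \<in> T \<Longrightarrow> norm g \<le> c * norm f"
    using T by (auto simp: bounded_operator_def)
  have "x \<in> closure (Domain T)" using dense by simp
  then obtain F where F: "\<And>n. F n \<in> Domain T" "F \<longlonglongrightarrow> x"
    by (auto simp: closure_sequential)
  from F(1) obtain G where G: "\<And>n. (F n, G n) \<in> T"
    unfolding Domain_iff by metis
  have "Cauchy G"
  proof (rule metric_CauchyI)
    fix e :: real assume e: "e > 0"
    \<comment> \<open>The constant in \<open>bounded_operator\<close> may be any real number;
      \<open>\<bar>c\<bar> + 1\<close> is a positive bound.\<close>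
    define d where "d = e / (\<bar>c\<bar> + 1)"
    have "d > 0" using e by (simp add: d_def add_nonneg_pos)
    moreover have "Cauchy F" using F(2) LIMSEQ_imp_Cauchy by blast
    ultimately obtain M where M: "\<And>m n. m \<ge> M \<Longrightarrow> n \<ge> M \<Longrightarrow> dist (F m) (F n) < d"
      using metric_CauchyD by blast
    show "\<exists>M. \<forall>m\<ge>M. \<forall>n\<ge>M. dist (G m) (G n) < e"
    proof (intro exI allI impI)
      fix m n assume mn: "m \<ge> M" "n \<ge> M"
      have "norm (G m - G n) \<le> c * norm (F m - F n)"
        by (rule c) (rule linear_operator_diff[OF lin G G])
      also have "\<dots> \<le> (\<bar>c\<bar> + 1) * norm (F m - F n)" by (intro mult_right_mono) auto
      also have "\<dots> < (\<bar>c\<bar> + 1) * d"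
        using M[OF mn] by (intro mult_strict_left_mono) (auto simp: dist_norm)
      also have "\<dots> = e" by (simp add: d_def)
      finally show "dist (G m) (G n) < e" by (simp add: dist_norm)
    qed
  qed
  then obtain y where "G \<longlonglongrightarrow> y" using Cauchy_convergent convergent_def by blast
  then have "(\<lambda>n. (F n, G n)) \<longlonglongrightarrow> (x, y)" by (intro tendsto_intros F)
  with G have "(x, y) \<in> closure T"
    unfolding closure_sequential by (intro exI[of _ "\<lambda>n. (F n, G n)"]) simp
  then show ?thesis ..
qed

text \<open>The closure is defined everywhere, and a symmetric operator defined everywhere is its
  own adjoint: the value of the adjoint at \<open>x\<close> and that of the closure have the same
  inner product with every vector.\<close>

lemma bounded_symmetric_closure_selfadjoint:
  assumes T: "bounded_operator T" and dense: "closure (Domain T) = UNIV"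
    and symm: "\<And>f g f' g'. (f, g) \<in> T \<Longrightarrow> (f', g') \<in> T \<Longrightarrow> cinner g f' = cinner f g'"
  shows "essentially_selfadjoint_in UNIV T"
proof -
  have lin: "linear_operator T" using T by (simp add: bounded_operator_def)
  obtain c where c: "\<And>f g. (f, g) \<in> T \<Longrightarrow> norm g \<le> c * norm f"
    using T by (auto simp: bounded_operator_def)
  have cl: "\<exists>F G. (\<forall>n. (F n, G n) \<in> T) \<and> F \<longlonglongrightarrow> x \<and> G \<longlonglongrightarrow> y" if xy: "(x, y) \<in> closure T" for x y
  proof -
    obtain p where p: "\<And>n::nat. p n \<in> T" "p \<longlonglongrightarrow> (x, y)"
      using xy by (auto simp: closure_sequential)
    show ?thesis
      using p(1) tendsto_fst[OF p(2)] tendsto_snd[OF p(2)]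
      by (intro exI[of _ "\<lambda>n. fst (p n)"] exI[of _ "\<lambda>n. snd (p n)"]) auto
  qed
  have clI: "(x, y) \<in> closure T" if "\<And>n. (F n, G n) \<in> T" "F \<longlonglongrightarrow> x" "G \<longlonglongrightarrow> y" for F G x y
    unfolding closure_sequential
    using that by (intro exI[of _ "\<lambda>n. (F n, G n)"]) (auto intro: tendsto_intros)
  have lincl: "linear_operator (closure T)"
  proof (rule linear_operatorI)
    show "(0, 0) \<in> closure T" using linear_operator_0[OF lin] closure_subset by blast
  next
    fix f g f' g' assume "(f, g) \<in> closure T" "(f', g') \<in> closure T"
    then obtain F G F' G' where "\<And>n. (F n, G n) \<in> T" "F \<longlonglongrightarrow> f" "G \<longlonglongrightarrow> g"
      "\<And>n. (F' n, G' n) \<in> T" "F' \<longlonglongrightarrow> f'" "G' \<longlonglongrightarrow> g'"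
      using cl by metis
    then show "(f + f', g + g') \<in> closure T"
      by (intro clI[of "\<lambda>n. F n + F' n" "\<lambda>n. G n + G' n"] linear_operator_add[OF lin] tendsto_add)
  next
    fix a f g assume "(f, g) \<in> closure T"
    then obtain F G where "\<And>n. (F n, G n) \<in> T" "F \<longlonglongrightarrow> f" "G \<longlonglongrightarrow> g"
      using cl by metis
    then show "(a *\<^sub>C f, a *\<^sub>C g) \<in> closure T"
      by (intro clI[of "\<lambda>n. a *\<^sub>C F n" "\<lambda>n. a *\<^sub>C G n"] linear_operator_scaleC[OF lin]
          scaleC.tendsto tendsto_const)
  next
    fix g assume "(0, g) \<in> closure T"
    then obtain F G where FG: "\<And>n. (F n, G n) \<in> T" "F \<longlonglongrightarrow> 0" "G \<longlonglongrightarrow> g"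
      using cl by blast
    have "(\<lambda>n. c * norm (F n)) \<longlonglongrightarrow> 0"
      by (intro tendsto_mult_right_zero tendsto_norm_zero FG(2))
    then have "G \<longlonglongrightarrow> 0"
      by (rule Lim_null_comparison[rotated]) (use c[OF FG(1)] in simp)
    then show "g = 0" using FG(3) LIMSEQ_unique by blast
  qed
  have symcl: "cinner g f' = cinner f g'" if fg: "(f, g) \<in> closure T" "(f', g') \<in> closure T" for f g f' g'
  proof -
    obtain F G where FG: "\<And>n. (F n, G n) \<in> T" "F \<longlonglongrightarrow> f" "G \<longlonglongrightarrow> g"
      using cl[OF fg(1)] by blast
    obtain F' G' where FG': "\<And>n. (F' n, G' n) \<in> T" "F' \<longlonglongrightarrow> f'" "G' \<longlonglongrightarrow> g'"
      using cl[OF fg(2)] by blast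
    have "(\<lambda>n. cinner (G n) (F' n)) \<longlonglongrightarrow> cinner g f'"
      by (intro cinner.tendsto FG FG')
    moreover have "(\<lambda>n. cinner (F n) (G' n)) \<longlonglongrightarrow> cinner f g'"
      by (intro cinner.tendsto FG FG')
    moreover have "cinner (G n) (F' n) = cinner (F n) (G' n)" for n
      by (rule symm[OF FG(1) FG'(1)])
    ultimately show ?thesis using LIMSEQ_unique by simp
  qed
  have total: "\<exists>y. (x, y) \<in> closure T" for x
    by (rule bounded_densely_defined_extends[OF T dense])
  have "adjoint_op (closure T) = closure T"
  proof
    show "closure T \<subseteq> adjoint_op (closure T)"
      using symcl by (auto simp: adjoint_on_def)
    show "adjoint_op (closure T) \<subseteq> closure T"
    proof clarify
      fix x y assume "(x, y) \<in> adjoint_op (closure T)"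
      then have adj: "cinner k x = cinner f y" if "(f, k) \<in> closure T" for f k
        using that by (auto simp: adjoint_on_def)
      obtain y' where y': "(x, y') \<in> closure T" using total by blast
      have "cinner f (y - y') = 0" for f
        using total[of f] adj symcl[OF _ y'] by (auto simp: cinner_simps)
      from this[of "y - y'"] have "y = y'" by simp
      then show "(x, y) \<in> closure T" using y' by simp
    qed
  qed
  moreover have "Domain (closure T) = UNIV" using total by blast
  ultimately show ?thesis
    using lin lincl by (simp add: essentially_selfadjoint_in_def selfadjoint_in_def)
qed

text \<open>Isolates what the last claim of the theorem takes from the Shtraus extensions at
  \<open>z\<close> and \<open>cnj z\<close>: a common dense domain, mutual adjointness and a bounded
  difference.\<close>

locale mutually_adjoint =
  fixes T T' :: "('a::complex_hilbert \<times> 'a) set"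
  assumes lin: "linear_operator T" and lin': "linear_operator T'"
    and adj: "adjoint_op T = T'" and adj': "adjoint_op T' = T"
    and dom: "Domain T' = Domain T" and dense: "closure (Domain T) = UNIV"
    and bounded: "bounded_operator (op_minus T T')"
begin

lemma cinner_swap: "\<lbrakk>(f, g) \<in> T; (f', g') \<in> T'\<rbrakk> \<Longrightarrow> cinner g f' = cinner f g'"
  using adj by (auto simp: adjoint_on_def)

lemma cinner_swap': "\<lbrakk>(f, g) \<in> T'; (f', g') \<in> T\<rbrakk> \<Longrightarrow> cinner g f' = cinner f g'"
  using adj' by (auto simp: adjoint_on_def)

definition "re_part = op_scale (1 / 2) (op_plus T T')"

definition "im_part = op_scale (1 / (2 * \<i>)) (op_minus T T')"

lemma mem_re_part: "(f, h) \<in> re_part \<longleftrightarrow> (\<exists>g g'. (f, g) \<in> T \<and> (f, g') \<in> T' \<and> h = (1/2) *\<^sub>C (g + g'))"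
  unfolding re_part_def op_scale_def op_plus_def by blast

lemma mem_im_part: "(f, h) \<in> im_part \<longleftrightarrow> (\<exists>g g'. (f, g) \<in> T \<and> (f, g') \<in> T' \<and> h = (1/(2*\<i>)) *\<^sub>C (g - g'))"
  unfolding im_part_def op_scale_def op_minus_def by blast

lemma Domain_re_part: "Domain re_part = Domain T"
  using dom by (auto simp: Domain_iff mem_re_part) blast+

lemma Domain_im_part: "Domain im_part = Domain T"
  using dom by (auto simp: Domain_iff mem_im_part) blast+

lemma re_part_symmetric: "\<lbrakk>(f, h) \<in> re_part; (f', h') \<in> re_part\<rbrakk> \<Longrightarrow> cinner h f' = cinner f h'"
  using cinner_swap cinner_swap' by (auto simp: mem_re_part cinner_simps)

lemma im_part_symmetric: "\<lbrakk>(f, h) \<in> im_part; (f', h') \<in> im_part\<rbrakk> \<Longrightarrow> cinner h f' = cinner f h'"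
  using cinner_swap cinner_swap' by (auto simp: mem_im_part cinner_simps diff_divide_distrib right_diff_distrib)

lemma bounded_im_part: "bounded_operator im_part"
proof -
  obtain c where c: "\<And>f g. (f, g) \<in> op_minus T T' \<Longrightarrow> norm g \<le> c * norm f"
    using bounded by (auto simp: bounded_operator_def)
  have "norm g \<le> (c / 2) * norm f" if "(f, g) \<in> im_part" for f g
    using that c by (fastforce simp: im_part_def op_scale_def norm_scaleC norm_mult norm_divide)
  then show ?thesis
    unfolding bounded_operator_def im_part_def using linear_op_scale linear_op_minus lin lin' by blast
qed

lemma im_part_essentially_selfadjoint: "essentially_selfadjoint_in UNIV im_part"
  using bounded_symmetric_closure_selfadjoint[OF bounded_im_part] dense im_part_symmetric
  by (simp add: Domain_im_part)

text \<open>On the common domain \<open>T\<close> equals \<open>re_part\<close> plus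
  \<open>\<i>\<close> times the bounded \<open>im_part\<close>. A vector in the domain of the
  adjoint of \<open>re_part\<close> is therefore in the domain of \<open>T'\<close>, the adjoint of
  \<open>T\<close>; there symmetry and density fix the value.\<close>

lemma re_part_selfadjoint: "selfadjoint_in UNIV re_part"
proof -
  have "adjoint_op re_part = re_part"
  proof
    show "re_part \<subseteq> adjoint_op re_part"
      using re_part_symmetric by (auto simp: adjoint_on_def)
    show "adjoint_op re_part \<subseteq> re_part"
    proof clarify
      fix x y assume "(x, y) \<in> adjoint_op re_part"
      then have xy: "cinner h x = cinner f y" if "(f, h) \<in> re_part" for f h
        using that by (auto simp: adjoint_on_def)
      \<comment> \<open>\<open>b\<close> is the value at \<open>x\<close> of the everywhere defined
        extension of \<open>im_part\<close>, available before \<open>x\<close> is known to lie in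
        the domain.\<close>
      obtain b where b: "(x, b) \<in> closure im_part"
        using bounded_densely_defined_extends[OF bounded_im_part] dense
        by (auto simp: Domain_im_part)
      have im: "cinner h x = cinner f b" if fh: "(f, h) \<in> im_part" for f h
      proof -
        have "closed {p. cinner h (fst p) = cinner f (snd p)}"
          by (intro closed_Collect_eq cinner.continuous_on continuous_intros)
        moreover have "im_part \<subseteq> {p. cinner h (fst p) = cinner f (snd p)}"
          using im_part_symmetric[OF fh] by auto
        ultimately have "closure im_part \<subseteq> {p. cinner h (fst p) = cinner f (snd p)}"
          by (intro closure_minimal)
        then show ?thesis using b by auto
      qed
      have "cinner g x = cinner f (y - \<i> *\<^sub>C b)" if fg: "(f, g) \<in> T" for f g
      proof -
        obtain g' where g': "(f, g') \<in> T'" using fg dom by blast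
        have "((1/2) *\<^sub>C (g + g')) + \<i> *\<^sub>C ((1/(2*\<i>)) *\<^sub>C (g - g')) = (1/2 + 1/2) *\<^sub>C g"
          by (simp only: scaleC_scaleC scaleC_add_left scaleC_add_right scaleC.diff_right) simp
        then have "g = ((1/2) *\<^sub>C (g + g')) + \<i> *\<^sub>C ((1/(2*\<i>)) *\<^sub>C (g - g'))"
          by simp
        then have "cinner g x = cinner ((1/2) *\<^sub>C (g + g')) x + \<i> * cinner ((1/(2*\<i>)) *\<^sub>C (g - g')) x"
          by (metis cinner_add_left cinner_scaleC_left)
        also have "cinner ((1/2) *\<^sub>C (g + g')) x = cinner f y"
          by (rule xy) (use fg g' in \<open>auto simp: mem_re_part\<close>)
        also have "cinner ((1/(2*\<i>)) *\<^sub>C (g - g')) x = cinner f b"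
          by (rule im) (use fg g' in \<open>auto simp: mem_im_part\<close>)
        finally show ?thesis by (simp add: cinner_simps)
      qed
      then have "(x, y - \<i> *\<^sub>C b) \<in> T'"
        unfolding adj[symmetric] by (auto simp: adjoint_on_def)
      then have "x \<in> Domain re_part" using dom by (auto simp: Domain_re_part)
      then obtain h where h: "(x, h) \<in> re_part" by blast
      have "cinner (y - h) f = 0" if "f \<in> Domain T" for f
      proof -
        have "f \<in> Domain re_part" using that by (simp add: Domain_re_part)
        then obtain k where k: "(f, k) \<in> re_part" by blast
        have "cinner f (y - h) = 0"
          using xy[OF k] re_part_symmetric[OF k h] by (simp add: cinner_simps)
        then show ?thesis using cinner_eq_zero_commute by blast
      qed
      then have "y - h = 0" by (rule eq_zero_if_orth_dense[OF dense])
      then show "(x, y) \<in> re_part" using h by simp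
    qed
  qed
  moreover have "linear_operator re_part"
    unfolding re_part_def by (intro linear_op_scale linear_op_plus lin lin')
  ultimately show ?thesis
    using dense by (simp add: selfadjoint_in_def Domain_re_part)
qed

end

section \<open>Regular symmetric operators\<close>

locale regular_symmetric_operator =
  fixes S :: "('a::complex_hilbert \<times> 'a) set"
  assumes regular: "regular_symmetric S"
begin

abbreviation "H0 \<equiv> dom_space S"
abbreviation "P \<equiv> proj H0"
abbreviation "S0 \<equiv> compressed S"

lemma closed_S: "closed_operator S" and symmetric_S: "symmetric_operator S"
  and closed_S0: "closed_operator S0"
  using regular by (auto simp: regular_symmetric_def)

lemma linear_S: "linear_operator S" and linear_S0: "linear_operator S0"
  using closed_S closed_S0 by (auto simp: closed_operator_def)

lemma H0: "csubspace H0" "closed H0"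
  unfolding dom_space_def by (intro csubspace_closure csubspace_Domain linear_S) simp

lemma in_H0: "(f, g) \<in> S \<Longrightarrow> f \<in> H0"
  using closure_subset[of "Domain S"] by (auto simp: dom_space_def)

lemma S0_I: "(f, g) \<in> S \<Longrightarrow> (f, P g) \<in> S0"
  by (auto simp: compressed_def op_proj_def)

lemma S0_E: assumes "(f, y) \<in> S0" obtains g where "(f, g) \<in> S" "y = P g"
  using assms by (auto simp: compressed_def op_proj_def)

lemmas P_simps = proj_add[OF H0] proj_diff[OF H0] proj_scaleC[OF H0] proj_id[OF H0(1)]

lemma symmetric_S0: "symmetric_operator S0"
  unfolding symmetric_operator_def
proof (intro conjI linear_S0 ballI, clarify)
  fix f y assume "(f, y) \<in> S0"
  then obtain g where g: "(f, g) \<in> S" "y = P g" by (rule S0_E)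
  then show "Im (cinner y f) = 0"
    using symmetric_S cinner_proj(1)[OF H0 in_H0[OF g(1)]] by (auto simp: symmetric_operator_def)
qed

text \<open>The domain of \<open>S\<close> is dense in \<open>H0\<close>. Symmetry and defect
  relations only give pairings with this domain, and here they turn into equations in
  \<open>H0\<close>.\<close>

lemma eq_on_domain_imp_eq:
  assumes "h \<in> H0" "h' \<in> H0" "\<And>f g. (f, g) \<in> S \<Longrightarrow> cinner f h = cinner f h'"
  shows "h = h'"
proof -
  have "h - h' \<in> orth (Domain S)"
    using assms(3) by (subst orth_def) (auto simp: cinner.diff_left intro: cinner_commute[THEN trans]
        simp: cinner_commute[of h] cinner_commute[of h'])
  then have "h - h' \<in> orth H0" by (simp add: dom_space_def)
  moreover have "h - h' \<in> H0" using assms csubspace_diff[OF H0(1)] by blast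
  ultimately show ?thesis using orth_Int_self[of "h - h'"] by simp
qed

text \<open>For \<open>\<phi>\<close> in the defect subspace, pairing with the projection of a
  vector onto that subspace is pairing with the vector itself. Orthogonality to
  \<open>defect_image S a\<close> is thus orthogonality to \<open>orth H0\<close>, that is,
  membership in \<open>H0\<close>.\<close>

lemma semi_defect_eq: "semi_defect S a = defect S a \<inter> H0"
proof -
  let ?N = "defect S a"
  note N = csubspace_defect[of S a] closed_defect[of S a]
  have "\<phi> \<in> orth (defect_image S a) \<longleftrightarrow> \<phi> \<in> orth (orth H0)" if "\<phi> \<in> ?N" for \<phi>
    using cinner_proj(2)[OF N that] by (auto simp: orth_def[of "orth _"] orth_def[of "_ ` _"] defect_image_def)
  then show ?thesis
    unfolding semi_defect_def orth_orth[OF H0] by auto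
qed

lemma csubspace_semi_defect: "csubspace (semi_defect S a)"
  unfolding semi_defect_eq by (intro csubspace_Int csubspace_defect H0)

lemma ran_shift_S0_sub: "ran_shift S0 a \<subseteq> H0"
  unfolding ran_shift_def
  using proj_in[OF H0] in_H0 H0(1)
  by (auto elim!: S0_E intro!: csubspace_diff csubspace_scaleC)

lemma semi_defect_iff:
  "n \<in> semi_defect S a \<longleftrightarrow> n \<in> H0 \<and> (\<forall>f y. (f, y) \<in> S0 \<longrightarrow> cinner y n = cnj a * cinner f n)"
  unfolding semi_defect_eq using cinner_proj(1)[OF H0]
  by (auto simp: mem_defect_iff elim!: S0_E dest: S0_I) (metis S0_I)

text \<open>Regular type makes the range closed, and its orthogonal complement within
  \<open>H0\<close> is the semi-defect subspace at the conjugate point.\<close>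

lemma ran_shift_S0_eq:
  assumes a: "a \<in> regular_type_points S0" and N: "semi_defect S (cnj a) = {0}"
  shows "ran_shift S0 a = H0"
proof (rule csubspace_eq_if_orth_trivial)
  have "n = 0" if "n \<in> H0" "n \<in> orth (ran_shift S0 a)" for n
  proof -
    have "cinner y n = a * cinner f n" if fy: "(f, y) \<in> S0" for f y
    proof -
      have "cinner n (y - a *\<^sub>C f) = 0"
        using \<open>n \<in> orth (ran_shift S0 a)\<close> ran_shiftI[OF fy] by (auto simp: orth_def)
      then have "cinner (y - a *\<^sub>C f) n = 0" by (subst cinner_eq_zero_commute)
      then show ?thesis by (simp add: cinner_simps)
    qed
    then have "n \<in> semi_defect S (cnj a)" using \<open>n \<in> H0\<close> by (simp add: semi_defect_iff)
    then show ?thesis using N by simp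
  qed
  then show "H0 \<inter> orth (ran_shift S0 a) \<subseteq> {0}" by blast
qed (use csubspace_ran_shift[OF linear_S0] closed_ran_shift[OF closed_S0 a] H0 ran_shift_S0_sub in auto)

section \<open>Directness of the sum, the projected extension and its compression\<close>

lemma S0_bounded_below:
  assumes z: "z \<in> regular_type_points S0" and fg: "(f, g) \<in> S" "P g = z *\<^sub>C f"
  shows "f = 0"
proof -
  obtain k where k: "k > 0" "\<And>f y. (f, y) \<in> S0 \<Longrightarrow> k * norm f \<le> norm (y - z *\<^sub>C f)"
    using z by (auto simp: regular_type_points_def)
  have "k * norm f \<le> 0" using k(2)[OF S0_I[OF fg(1)]] fg(2) by simp
  then show ?thesis using k(1) by (simp add: mult_le_0_iff)
qed

text \<open>For a common vector \<open>f\<close> the symmetry relation and the defect relation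
  together say \<open>S0 f = z f\<close>; regular type for \<open>S0\<close> leaves only
  \<open>f = 0\<close>.\<close>

lemma Domain_Int_defect:
  assumes z: "z \<in> regular_type_points S0"
  shows "Domain S \<inter> defect S z \<subseteq> {0}"
proof clarify
  fix f g assume fg: "(f, g) \<in> S" and f: "f \<in> defect S z"
  have "P g = z *\<^sub>C f"
  proof (rule eq_on_domain_imp_eq)
    fix f' g' assume h: "(f', g') \<in> S"
    have "cinner f' (P g) = cinner f' g" by (rule cinner_proj(2)[OF H0 in_H0[OF h]])
    also have "\<dots> = cinner g' f" using symmetric_operator_cinner[OF symmetric_S h fg] by simp
    also have "\<dots> = cinner f' (z *\<^sub>C f)" using f h by (simp add: mem_defect_iff cinner_simps)
    finally show "cinner f' (P g) = cinner f' (z *\<^sub>C f)" .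
  qed (use proj_in[OF H0] in_H0[OF fg] H0(1) in \<open>auto intro: csubspace_scaleC\<close>)
  then show "f = 0" by (rule S0_bounded_below[OF z fg])
qed

lemma linear_shtraus: "z \<in> regular_type_points S0 \<Longrightarrow> linear_operator (shtraus S z)"
  unfolding shtraus_def by (intro linear_extend_by linear_S csubspace_defect Domain_Int_defect)

lemma shtrausE:
  assumes "(x, y) \<in> shtraus S z"
  obtains f g \<phi> where "(f, g) \<in> S" "\<phi> \<in> defect S z" "x = f + \<phi>" "y = g + z *\<^sub>C \<phi>"
  using assms by (auto simp: shtraus_def extend_by_def)

lemma shtrausI:
  "\<lbrakk>(f, g) \<in> S; \<phi> \<in> defect S z\<rbrakk> \<Longrightarrow> (f + \<phi>, g + z *\<^sub>C \<phi>) \<in> shtraus S z"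
  by (simp add: shtraus_def extend_byI)

lemma proj_shtraus_minus:
  assumes "(f, g) \<in> S" shows "P (g + z *\<^sub>C \<phi>) - z *\<^sub>C P (f + \<phi>) = P g - z *\<^sub>C f"
  using in_H0[OF assms] by (simp add: P_simps scaleC_add_right)

lemma closed_proj_shtraus:
  assumes z: "z \<in> regular_type_points S0"
  shows "closed_operator (op_proj H0 (shtraus S z))"
  unfolding closed_operator_def
proof
  show "linear_operator (op_proj H0 (shtraus S z))"
  proof (rule linear_operatorI)
    note lin = linear_shtraus[OF z]
    have I: "(x, P y) \<in> op_proj H0 (shtraus S z)" if "(x, y) \<in> shtraus S z" for x y
      using that by (auto simp: op_proj_def)
    show "(0, 0) \<in> op_proj H0 (shtraus S z)"
      using I[OF linear_operator_0[OF lin]] proj_id[OF H0(1) csubspace_0[OF H0(1)]] by simp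
    fix f g f' g' assume fg: "(f, g) \<in> op_proj H0 (shtraus S z)"
    then obtain y where y: "(f, y) \<in> shtraus S z" "g = P y" by (auto simp: op_proj_def)
    show "(c *\<^sub>C f, c *\<^sub>C g) \<in> op_proj H0 (shtraus S z)" for c
      using I[OF linear_operator_scaleC[OF lin y(1)], of c] y(2) by (simp add: P_simps)
    show "(f + f', g + g') \<in> op_proj H0 (shtraus S z)" if fg': "(f', g') \<in> op_proj H0 (shtraus S z)"
    proof -
      obtain y' where y': "(f', y') \<in> shtraus S z" "g' = P y'"
        using fg' by (auto simp: op_proj_def)
      show ?thesis
        using I[OF linear_operator_add[OF lin y(1) y'(1)]] y(2) y'(2) by (simp add: P_simps)
    qed
  next
    fix g assume "(0, g) \<in> op_proj H0 (shtraus S z)"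
    then obtain y where y: "(0, y) \<in> shtraus S z" "g = P y" by (auto simp: op_proj_def)
    have "y = 0"
      by (rule linear_operator_unique[OF linear_shtraus[OF z] y(1)
          linear_operator_0[OF linear_shtraus[OF z]]])
    then show "g = 0" using y proj_id[OF H0(1) csubspace_0[OF H0(1)]] by simp
  qed
  show "closed (op_proj H0 (shtraus S z))"
    unfolding closed_sequential_limits
  proof (intro allI impI, clarify)
    fix X x y assume X: "\<forall>n. X n \<in> op_proj H0 (shtraus S z)" "X \<longlonglongrightarrow> (x, y)"
    have "\<exists>f g \<phi>. (f, g) \<in> S \<and> \<phi> \<in> defect S z \<and> X n = (f + \<phi>, P (g + z *\<^sub>C \<phi>))" for n
      using X(1)[rule_format, of n] by (auto simp: op_proj_def elim!: shtrausE)
    then obtain F G \<Phi> where F: "\<And>n. (F n, G n) \<in> S" "\<And>n. \<Phi> n \<in> defect S z"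
      "\<And>n. X n = (F n + \<Phi> n, P (G n + z *\<^sub>C \<Phi> n))"
      by metis
    have x: "(\<lambda>n. F n + \<Phi> n) \<longlonglongrightarrow> x" and y: "(\<lambda>n. P (G n + z *\<^sub>C \<Phi> n)) \<longlonglongrightarrow> y"
      using tendsto_fst[OF X(2)] tendsto_snd[OF X(2)] by (simp_all add: F(3))
    have "(\<lambda>n. P (G n + z *\<^sub>C \<Phi> n) - z *\<^sub>C P (F n + \<Phi> n)) \<longlonglongrightarrow> y - z *\<^sub>C P x"
      by (intro tendsto_diff scaleC.tendsto tendsto_const tendsto_proj[OF H0] x y)
    then have "(\<lambda>n. P (G n) - z *\<^sub>C F n) \<longlonglongrightarrow> y - z *\<^sub>C P x"
      by (simp add: proj_shtraus_minus[OF F(1)])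
    then obtain f where f: "F \<longlonglongrightarrow> f" "(f, (y - z *\<^sub>C P x) + z *\<^sub>C f) \<in> S0"
      using convergent_if_shift_convergent[OF closed_S0 z, of F "\<lambda>n. P (G n)"] S0_I[OF F(1)]
      by metis
    obtain g where g: "(f, g) \<in> S" "(y - z *\<^sub>C P x) + z *\<^sub>C f = P g" using f(2) by (rule S0_E)
    \<comment> \<open>Convergence of the sums and of \<open>F\<close> forces that of
      \<open>\<Phi>\<close>, whose limit stays in the closed defect subspace.\<close>
    have "(\<lambda>n. (F n + \<Phi> n) - F n) \<longlonglongrightarrow> x - f" by (intro tendsto_diff x f)
    then have "\<Phi> \<longlonglongrightarrow> x - f" by simp
    then have phi: "x - f \<in> defect S z"
      using closed_sequentially[OF closed_defect] F(2) by metis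
    have "P (g + z *\<^sub>C (x - f)) = y"
      using g(2) in_H0[OF g(1)] by (simp add: P_simps scaleC.diff_right algebra_simps)
    then show "(x, y) \<in> op_proj H0 (shtraus S z)"
      using shtrausI[OF g(1) phi] by (force simp: op_proj_def)
  qed
qed

text \<open>The component \<open>f\<close> is in \<open>H0\<close> already, so restricting to
  \<open>H0\<close> cuts \<open>\<phi>\<close> down to the semi-defect subspace, on which
  \<open>P\<close> is the identity.\<close>

lemma compression_shtraus:
  "op_restrict (op_proj H0 (shtraus S z)) (Domain (shtraus S z) \<inter> H0) = shtraus_compressed S z"
proof (rule set_eqI, clarify)
  fix x y
  have "(x, y) \<in> op_restrict (op_proj H0 (shtraus S z)) (Domain (shtraus S z) \<inter> H0) \<longleftrightarrow>
      (\<exists>f g \<phi>. (f, g) \<in> S \<and> \<phi> \<in> defect S z \<and> x = f + \<phi> \<and> y = P (g + z *\<^sub>C \<phi>) \<and> x \<in> H0)"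
    unfolding op_restrict_def op_proj_def shtraus_def extend_by_def by blast
  also have "\<dots> \<longleftrightarrow>
      (\<exists>f g \<phi>. (f, g) \<in> S \<and> \<phi> \<in> semi_defect S z \<and> x = f + \<phi> \<and> y = P g + z *\<^sub>C \<phi>)"
  proof -
    have "f + \<phi> \<in> H0 \<longleftrightarrow> \<phi> \<in> H0" if "(f, g) \<in> S" for f g \<phi>
      using csubspace_add[OF H0(1) in_H0[OF that], of \<phi>]
        csubspace_diff[OF H0(1) _ in_H0[OF that], of "f + \<phi>"] by auto
    then show ?thesis
      unfolding semi_defect_eq by (metis (lifting) Int_iff P_simps(1,3,4))
  qed
  also have "\<dots> \<longleftrightarrow> (x, y) \<in> shtraus_compressed S z"
    unfolding shtraus_compressed_def extend_by_def compressed_def op_proj_def by blast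
  finally show "(x, y) \<in> op_restrict (op_proj H0 (shtraus S z)) (Domain (shtraus S z) \<inter> H0)
      \<longleftrightarrow> (x, y) \<in> shtraus_compressed S z" .
qed

section \<open>The projected extensions as restrictions of the adjoint of \<open>S\<close>, and
  their domains\<close>

lemma shtraus_dom_adjoint:
  assumes "(f, g) \<in> S" "\<phi> \<in> defect S z"
  shows "(f + \<phi>, P g + z *\<^sub>C P \<phi>) \<in> dom_adjoint S"
proof -
  have "cinner k (f + \<phi>) = cinner h (P g + z *\<^sub>C P \<phi>)" if hk: "(h, k) \<in> S" for h k
    using symmetric_operator_cinner[OF symmetric_S hk assms(1)] assms(2) hk
      cinner_proj(2)[OF H0 in_H0[OF hk]]
    by (simp add: cinner_simps mem_defect_iff)
  then show ?thesis
    using proj_in[OF H0] H0(1)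
    by (auto simp: dom_adjoint_def adjoint_on_def intro!: csubspace_add csubspace_scaleC)
qed

lemma dom_adjoint_unique:
  "\<lbrakk>(x, h) \<in> dom_adjoint S; (x, h') \<in> dom_adjoint S\<rbrakk> \<Longrightarrow> h = h'"
  by (rule eq_on_domain_imp_eq) (fastforce simp: dom_adjoint_def adjoint_on_def)+

lemma Domain_shtraus_sub: "Domain (shtraus S z) \<subseteq> Domain (dom_adjoint S)"
  using shtraus_dom_adjoint by (fastforce elim!: shtrausE)

lemma Domain_shtraus_eq:
  assumes z: "cnj z \<in> regular_type_points S0" and N: "semi_defect S z = {0}"
  shows "Domain (shtraus S (cnj z)) = Domain (dom_adjoint S)"
proof (rule antisym[OF Domain_shtraus_sub], clarify)
  fix x h assume "(x, h) \<in> dom_adjoint S"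
  then have h: "h \<in> H0" and xh: "\<And>f g. (f, g) \<in> S \<Longrightarrow> cinner g x = cinner f h"
    by (auto simp: dom_adjoint_def adjoint_on_def)
  have "h - cnj z *\<^sub>C P x \<in> ran_shift S0 (cnj z)"
    using ran_shift_S0_eq[OF z] N h proj_in[OF H0] H0(1)
    by (simp add: csubspace_diff csubspace_scaleC)
  then obtain f g where fg: "(f, g) \<in> S" "h - cnj z *\<^sub>C P x = P g - cnj z *\<^sub>C f"
    by (auto simp: ran_shift_def elim!: S0_E)
  have "x - f \<in> defect S (cnj z)"
    unfolding mem_defect_iff
  proof (intro allI impI)
    fix f' g' assume k: "(f', g') \<in> S"
    have "cinner g' (x - f) = cinner f' (h - P g)"
      using xh[OF k] symmetric_operator_cinner[OF symmetric_S k fg(1)]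
        cinner_proj(2)[OF H0 in_H0[OF k]] by (simp add: cinner_simps)
    \<comment> \<open>By the choice of \<open>f\<close>, the value \<open>h - P g\<close> of the
      adjoint at \<open>x - f\<close> is \<open>cnj z\<close> times the projection of
      \<open>x - f\<close>, which is the defect condition at \<open>cnj z\<close>.\<close>
    also have "h - P g = cnj z *\<^sub>C (P x - f)"
      using fg(2) by (simp add: scaleC.diff_right algebra_simps)
    finally show "cinner g' (x - f) = cnj (cnj z) * cinner f' (x - f)"
      using cinner_proj(2)[OF H0 in_H0[OF k]] by (simp add: cinner_simps)
  qed
  from shtrausI[OF fg(1) this] show "x \<in> Domain (shtraus S (cnj z))" by auto
qed

text \<open>A nonzero \<open>n\<close> in the semi-defect subspace at \<open>cnj z\<close> is the
  witness. Were \<open>n = f + \<phi>\<close>, then \<open>\<phi>\<close> would lie in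
  \<open>H0\<close> and vanish, leaving \<open>n\<close> both in the domain of \<open>S\<close> and
  in the defect subspace at \<open>cnj z\<close>, against directness there.\<close>

lemma Domain_shtraus_psubset:
  assumes z: "cnj z \<in> regular_type_points S0"
    and N: "semi_defect S z = {0}" "semi_defect S (cnj z) \<noteq> {0}"
  shows "Domain (shtraus S z) \<subset> Domain (dom_adjoint S)"
proof -
  obtain n where n: "n \<in> semi_defect S (cnj z)" "n \<noteq> 0"
    using N(2) csubspace_0[OF csubspace_semi_defect] by blast
  then have nn: "n \<in> defect S (cnj z)" "n \<in> H0" by (auto simp: semi_defect_eq)
  have "n \<notin> Domain (shtraus S z)"
  proof
    assume "n \<in> Domain (shtraus S z)"
    then obtain f g \<phi> where f: "(f, g) \<in> S" "\<phi> \<in> defect S z" "n = f + \<phi>"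
      by (auto elim!: shtrausE)
    have "\<phi> \<in> H0" using csubspace_diff[OF H0(1) nn(2) in_H0[OF f(1)]] f(3) by simp
    then have "\<phi> = 0" using N(1) f(2) by (auto simp: semi_defect_eq)
    then have "n \<in> Domain S \<inter> defect S (cnj z)" using f nn by auto
    then show False using Domain_Int_defect[OF z] n(2) by auto
  qed
  moreover have "n \<in> Domain (dom_adjoint S)"
    using shtraus_dom_adjoint[OF linear_operator_0[OF linear_S] nn(1)] by auto
  ultimately show ?thesis using Domain_shtraus_sub by blast
qed

text \<open>Were \<open>n \<noteq> 0\<close> in the deficiency subspace at \<open>z\<close>, solving \<open>(S\<^sub>0 - cnj u) f = (z - cnj u) n\<close>
  would put \<open>m = n - f\<close> in the one at \<open>cnj u\<close>; the imaginary part of the form of the adjoint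
  of \<open>S\<^sub>0\<close> at \<open>n = f + m\<close> would then be both \<open>Im z \<parallel>n\<parallel>\<^sup>2\<close> and \<open>- Im u \<parallel>m\<parallel>\<^sup>2\<close>.\<close>

lemma semi_defect_trivial_half_plane:
  assumes uz: "Im u * Im z > 0" and N: "semi_defect S u = {0}"
  shows "semi_defect S z = {0}"
proof -
  have "n = 0" if n: "n \<in> semi_defect S z" for n
  proof -
    have nH: "n \<in> H0" and nS: "\<And>f y. (f, y) \<in> S0 \<Longrightarrow> cinner y n = cnj z * cinner f n"
      using n by (auto simp: semi_defect_iff)
    have "Im (cnj u) \<noteq> 0" using uz by auto
    then have "ran_shift S0 (cnj u) = H0"
      using N by (intro ran_shift_S0_eq nonreal_regular_type symmetric_S0) auto
    then have "(z - cnj u) *\<^sub>C n \<in> ran_shift S0 (cnj u)" using nH H0(1) csubspace_scaleC by blast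
    then obtain f y where fy: "(f, y) \<in> S0" and "(z - cnj u) *\<^sub>C n = y - cnj u *\<^sub>C f"
      by (auto simp: ran_shift_def)
    then have y: "y = z *\<^sub>C n - cnj u *\<^sub>C (n - f)"
      by (simp add: scaleC.diff_left scaleC.diff_right algebra_simps)
    define m where "m = n - f"
    have ym: "y + cnj u *\<^sub>C m = z *\<^sub>C n" by (simp add: y m_def)
    have yf: "Im (cinner y f) = 0"
      using symmetric_S0 fy by (auto simp: symmetric_operator_def)
    have "cinner y m = cinner y n - cinner y f" by (simp add: m_def cinner_simps)
    also have "cinner y n = cinner f (z *\<^sub>C n)" using nS[OF fy] by (simp add: cinner_simps)
    also have "z *\<^sub>C n = y + cnj u *\<^sub>C m" by (simp add: ym)
    also have "cinner f (y + cnj u *\<^sub>C m) - cinner y f = u * cinner f m"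
      using symmetric_operator_cinner[OF symmetric_S0 fy fy] by (simp add: cinner_simps)
    finally have "cinner y m = u * cinner f m" .
    then have "Im (cinner y m + cinner (cnj u *\<^sub>C m) f) = 0"
      using cinner_commute[of m f] by (simp add: cinner_simps)
    moreover have "z * cinner n n = cinner (y + cnj u *\<^sub>C m) (f + m)"
      unfolding ym by (simp add: m_def cinner_scaleC_left)
    then have "z * cinner n n = cinner y f + (cinner y m + cinner (cnj u *\<^sub>C m) f)
        + cnj u * cinner m m"
      by (simp add: cinner_simps)
    then have "Im (z * cinner n n) = Im (cinner y f)
        + Im (cinner y m + cinner (cnj u *\<^sub>C m) f) + Im (cnj u * cinner m m)"
      by simp
    ultimately have "Im z * (norm n)\<^sup>2 = - Im u * (norm m)\<^sup>2"
      using yf by (simp add: cinner_self)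
    \<comment> \<open>Multiplying by \<open>Im u\<close> treats both half-planes at once: the left
      side becomes a positive multiple of \<open>(norm n)\<^sup>2\<close>, the right side is
      nonpositive.\<close>
    then have "Im u * (Im z * (norm n)\<^sup>2) = Im u * (- Im u * (norm m)\<^sup>2)" by (rule arg_cong)
    then have "(Im u * Im z) * (norm n)\<^sup>2 = - ((Im u)\<^sup>2 * (norm m)\<^sup>2)"
      by (simp add: power2_eq_square)
    then have "(Im u * Im z) * (norm n)\<^sup>2 \<le> 0" by simp
    then show "n = 0" using mult_pos_pos[OF uz, of "(norm n)\<^sup>2"] by (cases "n = 0") auto
  qed
  then show ?thesis using csubspace_0[OF csubspace_semi_defect] by blast
qed

text \<open>A nonzero \<open>n\<close> in this subspace would be an eigenvector, with eigenvalue
  \<open>a\<close>, of the adjoint of \<open>S0\<close> and hence of \<open>S0\<close> itself,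
  against regular type. The argument covers real \<open>a\<close>.\<close>

lemma semi_defect_trivial_if_selfadjoint:
  assumes sa: "selfadjoint_in H0 S0" and a: "a \<in> regular_type_points S0"
  shows "semi_defect S a = {0}"
proof -
  have "n = 0" if n: "n \<in> semi_defect S a" for n
  proof -
    have "(n, a *\<^sub>C n) \<in> adjoint_on H0 H0 S0"
      using n H0(1) by (auto simp: semi_defect_iff adjoint_on_def cinner_simps csubspace_scaleC)
    then have "(n, a *\<^sub>C n) \<in> S0" using sa by (auto simp: selfadjoint_in_def)
    then show ?thesis by (elim S0_E) (metis S0_bounded_below[OF a])
  qed
  then show ?thesis using csubspace_0[OF csubspace_semi_defect] by blast
qed

text \<open>This is where regularity enters: closedness of both \<open>S\<close> and \<open>S\<^sub>0\<close> bounds \<open>S\<close> relative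
  to \<open>S\<^sub>0\<close>.\<close>

lemma S_bounded_by_S0:
  assumes a: "a \<in> regular_type_points S0"
  obtains C where "C \<ge> 0" "\<And>f g. (f, g) \<in> S \<Longrightarrow> norm g \<le> C * norm (P g - a *\<^sub>C f)"
proof -
  \<comment> \<open>\<open>R\<close> is the graph of \<open>S\<close> composed with the inverse of
    \<open>S0 - a\<close>. Its domain is the range of \<open>S0 - a\<close>, closed by regular type,
    as the closed graph theorem requires.\<close>
  define R where "R = {(P g - a *\<^sub>C f, g) | f g. (f, g) \<in> S}"
  have RI: "(f, g) \<in> S \<Longrightarrow> (P g - a *\<^sub>C f, g) \<in> R" for f g
    by (auto simp: R_def)
  have sv: "single_valued R"
  proof (rule single_valuedI, unfold R_def, clarify)
    fix f g f' g' assume fg: "(f, g) \<in> S" "(f', g') \<in> S"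
      and eq: "P g - a *\<^sub>C f = P g' - a *\<^sub>C f'"
    have d: "(f - f', g - g') \<in> S" by (rule linear_operator_diff[OF linear_S fg])
    moreover have "P (g - g') = a *\<^sub>C (f - f')"
      using eq by (simp add: P_simps scaleC.diff_right algebra_simps)
    ultimately have "f - f' = 0" by (rule S0_bounded_below[OF a])
    then show "g = g'"
      using fg linear_operator_unique[OF linear_S] by auto
  qed
  have sub: "subspace R"
    unfolding subspace_def
  proof (intro conjI ballI allI)
    show "0 \<in> R"
      using RI[OF linear_operator_0[OF linear_S]] proj_id[OF H0(1) csubspace_0[OF H0(1)]]
      by (simp add: zero_prod_def)
    fix p q c assume p: "p \<in> R" 
    then obtain f g where f: "(f, g) \<in> S" "p = (P g - a *\<^sub>C f, g)" by (auto simp: R_def)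
    show "c *\<^sub>R p \<in> R"
      using RI[OF linear_operator_scaleC[OF linear_S f(1)], of "of_real c"] f(2)
      by (simp add: scaleR_scaleC P_simps scaleC_scaleC scaleC.diff_right mult.commute)
    assume "q \<in> R"
    then obtain f' g' where f': "(f', g') \<in> S" "q = (P g' - a *\<^sub>C f', g')" by (auto simp: R_def)
    show "p + q \<in> R"
      using RI[OF linear_operator_add[OF linear_S f(1) f'(1)]] f(2) f'(2)
      by (simp add: P_simps scaleC_add_right add_diff_add)
  qed
  have cl: "closed R"
    unfolding closed_sequential_limits
  proof (intro allI impI, clarify)
    fix X x y assume X: "\<forall>n. X n \<in> R" "X \<longlonglongrightarrow> (x, y)"
    have "\<exists>f. (f, snd (X n)) \<in> S \<and> fst (X n) = P (snd (X n)) - a *\<^sub>C f" for n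
      using X(1)[rule_format, of n] by (auto simp: R_def)
    then obtain F where F: "\<And>n. (F n, snd (X n)) \<in> S"
      "\<And>n. fst (X n) = P (snd (X n)) - a *\<^sub>C F n" by metis
    have 1: "(\<lambda>n. P (snd (X n)) - a *\<^sub>C F n) \<longlonglongrightarrow> x"
      using tendsto_fst[OF X(2)] by (simp flip: F(2))
    have 2: "(\<lambda>n. snd (X n)) \<longlonglongrightarrow> y" using tendsto_snd[OF X(2)] by simp
    \<comment> \<open>\<open>R\<close> does not record the arguments \<open>F n\<close>; their
      convergence is recovered from that of the shifted values of \<open>S0\<close>.\<close>
    obtain f where f: "F \<longlonglongrightarrow> f"
      using convergent_if_shift_convergent[OF closed_S0 a S0_I[OF F(1)] 1] by blast
    have "(\<lambda>n. (F n, snd (X n))) \<longlonglongrightarrow> (f, y)" by (intro tendsto_intros f 2)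
    then have fy: "(f, y) \<in> S"
      using closed_sequentially[of S "\<lambda>n. (F n, snd (X n))"] closed_S F(1)
      by (simp add: closed_operator_def)
    have "(\<lambda>n. P (snd (X n)) - a *\<^sub>C F n) \<longlonglongrightarrow> P y - a *\<^sub>C f"
      by (intro tendsto_diff scaleC.tendsto tendsto_const tendsto_proj[OF H0] f 2)
    then have "x = P y - a *\<^sub>C f" using 1 LIMSEQ_unique by blast
    then show "(x, y) \<in> R" using RI[OF fy] by simp
  qed
  have "Domain R = ran_shift S0 a"
    unfolding R_def ran_shift_def compressed_def op_proj_def by blast
  then have "closed (Domain R)" using closed_ran_shift[OF closed_S0 a] by simp
  then obtain C where "C \<ge> 0" "\<And>x y. (x, y) \<in> R \<Longrightarrow> norm y \<le> C * norm x"
    using closed_graph_bound[OF cl sub sv] by blast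
  then show thesis using that RI by blast
qed

text \<open>Write \<open>P \<phi>\<close> as \<open>(S0 - cnj z) f\<close>. As \<open>\<phi>\<close>
  is orthogonal to \<open>(S - cnj z) f\<close>, which is \<open>P \<phi> + (g - P g)\<close>, the
  square of \<open>norm (P \<phi>)\<close> is the modulus of the pairing of \<open>g - P g\<close>
  with \<open>\<phi> - P \<phi>\<close>. The bound of \<open>S\<close> relative to \<open>S0\<close>
  gives \<open>norm (g - P g) \<le> C * norm (P \<phi>)\<close>, and one factor cancels.\<close>

lemma defect_bound:
  assumes z: "cnj z \<in> regular_type_points S0" and N: "semi_defect S z = {0}"
  obtains C where "C \<ge> 0" "\<And>\<phi>. \<phi> \<in> defect S z \<Longrightarrow> norm \<phi> \<le> C * norm (\<phi> - P \<phi>)"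
proof -
  obtain C where C: "C \<ge> 0" "\<And>f g. (f, g) \<in> S \<Longrightarrow> norm g \<le> C * norm (P g - cnj z *\<^sub>C f)"
    using S_bounded_by_S0[OF z] by blast
  have "norm \<phi> \<le> (C + 1) * norm (\<phi> - P \<phi>)" if phi: "\<phi> \<in> defect S z" for \<phi>
  proof -
    have "P \<phi> \<in> ran_shift S0 (cnj z)"
      using ran_shift_S0_eq[OF z] N proj_in[OF H0] by simp
    then obtain f g where fg: "(f, g) \<in> S" "P \<phi> = P g - cnj z *\<^sub>C f"
      by (auto simp: ran_shift_def elim!: S0_E)
    have "cinner (g - cnj z *\<^sub>C f) \<phi> = 0"
      using phi fg(1) by (simp add: mem_defect_iff cinner_simps)
    moreover have "g - cnj z *\<^sub>C f = P \<phi> + (g - P g)" using fg(2) by simp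
    ultimately have "cinner (P \<phi>) \<phi> + cinner (g - P g) \<phi> = 0"
      by (simp add: cinner_add_left)
    moreover have "cinner (P \<phi>) \<phi> = of_real ((norm (P \<phi>))\<^sup>2)"
      using cinner_proj(2)[OF H0 proj_in[OF H0], of \<phi> \<phi>] by (simp add: cinner_self)
    moreover have "cinner (g - P g) (P \<phi>) = 0"
      using proj_orth[OF H0] proj_in[OF H0] by (auto simp: orth_def)
    then have "cinner (g - P g) \<phi> = cinner (g - P g) (\<phi> - P \<phi>)"
      by (simp add: cinner.diff_right)
    ultimately have "complex_of_real ((norm (P \<phi>))\<^sup>2) = - cinner (g - P g) (\<phi> - P \<phi>)"
      by (simp add: eq_neg_iff_add_eq_0)
    then have "cmod (complex_of_real ((norm (P \<phi>))\<^sup>2)) = cmod (cinner (g - P g) (\<phi> - P \<phi>))"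
      by (simp only: norm_minus_cancel)
    then have "(norm (P \<phi>))\<^sup>2 = cmod (cinner (g - P g) (\<phi> - P \<phi>))"
      by (simp only: norm_of_real abs_power2)
    also have "\<dots> \<le> norm (g - P g) * norm (\<phi> - P \<phi>)" by (rule cinner_norm_le)
    also have "\<dots> \<le> (C * norm (P \<phi>)) * norm (\<phi> - P \<phi>)"
      using norm_proj_le(2)[OF H0, of g] C(2)[OF fg(1)] fg(2) by (intro mult_right_mono) auto
    finally have "norm (P \<phi>) * norm (P \<phi>) \<le> norm (P \<phi>) * (C * norm (\<phi> - P \<phi>))"
      by (simp add: power2_eq_square mult_ac)
    then have "norm (P \<phi>) \<le> C * norm (\<phi> - P \<phi>)"
      using C(1) by (cases "P \<phi> = 0") auto
    then show ?thesis
      using norm_triangle_ineq[of "P \<phi>" "\<phi> - P \<phi>"] by (simp add: algebra_simps)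
  qed
  then show thesis using that[of "C + 1"] C(1) by auto
qed

lemma mutually_adjoint_shtraus:
  assumes zS: "z \<in> regular_type_points S" and z: "z \<in> regular_type_points S0"
    and sa: "selfadjoint_in H0 S0"
  shows "mutually_adjoint (shtraus S z) (shtraus S (cnj z))"
    and "Domain (shtraus S z) = Domain (dom_adjoint S)"
proof -
  note zS' = regular_type_cnj[OF symmetric_S zS]
  note z' = regular_type_cnj[OF symmetric_S0 z]
  note N = semi_defect_trivial_if_selfadjoint[OF sa z]
  note N' = semi_defect_trivial_if_selfadjoint[OF sa z']
  show D: "Domain (shtraus S z) = Domain (dom_adjoint S)"
    using Domain_shtraus_eq[of "cnj z"] z N' by simp
  have D': "Domain (shtraus S (cnj z)) = Domain (dom_adjoint S)"
    using Domain_shtraus_eq[OF z' N] .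
  \<comment> \<open>A vector orthogonal to the domain has the form \<open>(S - cnj z) f\<close> and
    has zero projection onto \<open>H0\<close>; so \<open>S0 f = cnj z f\<close>, which forces
    \<open>f = 0\<close>.\<close>
  have dense: "closure (Domain (shtraus S z)) = UNIV"
  proof (rule closure_eq_UNIV_if_orth_trivial)
    show "csubspace (Domain (shtraus S z))"
      by (intro csubspace_Domain linear_shtraus z)
    fix w assume w: "w \<in> orth (Domain (shtraus S z))"
    have "f \<in> Domain (shtraus S z)" if "(f, g) \<in> S" for f g
      using shtrausI[OF that csubspace_0[OF csubspace_defect]] by auto
    then have "w \<in> orth (Domain S)" using w by (auto simp: orth_def)
    then have wL: "w \<in> orth H0" by (simp add: dom_space_def)
    have "\<phi> \<in> Domain (shtraus S z)" if "\<phi> \<in> defect S z" for \<phi>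
      using shtrausI[OF linear_operator_0[OF linear_S] that] by auto
    then have "w \<in> orth (defect S z)" using w by (auto simp: orth_def)
    also have "orth (defect S z) = ran_shift S (cnj z)"
      unfolding defect_def
      by (intro orth_orth csubspace_ran_shift linear_S closed_ran_shift closed_S zS')
    finally obtain f g where fg: "(f, g) \<in> S" "w = g - cnj z *\<^sub>C f"
      by (auto simp: ran_shift_def)
    have "P w = 0"
      by (rule proj_eqI) (use wL H0 in \<open>auto intro: csubspace_0\<close>)
    then have "P g = cnj z *\<^sub>C f" using fg in_H0[OF fg(1)] by (simp add: P_simps)
    then have "f = 0" by (rule S0_bounded_below[OF z' fg(1)])
    then show "w = 0"
      using fg linear_operator_unique[OF linear_S _ linear_operator_0[OF linear_S]] by auto
  qed
  obtain C1 where C1: "C1 \<ge> 0" "\<And>\<phi>. \<phi> \<in> defect S z \<Longrightarrow> norm \<phi> \<le> C1 * norm (\<phi> - P \<phi>)"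
    using defect_bound[OF z' N] by blast
  obtain C2 where C2: "C2 \<ge> 0"
      "\<And>\<phi>. \<phi> \<in> defect S (cnj z) \<Longrightarrow> norm \<phi> \<le> C2 * norm (\<phi> - P \<phi>)"
    using defect_bound[of "cnj z"] z N' by auto
  obtain C where C: "C \<ge> 0" "\<And>f g. (f, g) \<in> S \<Longrightarrow> norm g \<le> C * norm (P g - z *\<^sub>C f)"
    using S_bounded_by_S0[OF z] by blast
  \<comment> \<open>\<open>C1\<close> and \<open>C2\<close> bound the two defect vectors by
    \<open>norm x\<close>. Each of these enters with weight \<open>cmod z\<close> directly and
    \<open>2 * C * cmod z\<close> through the difference \<open>g - g'\<close>.\<close>
  define M where "M = (2 * C + 1) * cmod z * (C1 + C2)"
  have bound: "norm (y - y') \<le> M * norm x"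
    if xy: "(x, y) \<in> shtraus S z" "(x, y') \<in> shtraus S (cnj z)" for x y y'
  proof -
    obtain f g \<phi> where f: "(f, g) \<in> S" "\<phi> \<in> defect S z" "x = f + \<phi>" "y = g + z *\<^sub>C \<phi>"
      using xy(1) by (rule shtrausE)
    obtain f' g' \<psi> where f': "(f', g') \<in> S" "\<psi> \<in> defect S (cnj z)" "x = f' + \<psi>"
        "y' = g' + cnj z *\<^sub>C \<psi>"
      using xy(2) by (rule shtrausE)
    \<comment> \<open>In either decomposition the summand from the domain of \<open>S\<close> has no
      component orthogonal to \<open>H0\<close>, so this component of \<open>x\<close> is that of
      the defect vector.\<close>
    have comp: "norm (x - P x) = norm (\<eta> - P \<eta>)" if "x = h + \<eta>" "h \<in> H0" for h \<eta>
      using that by (simp add: P_simps)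
    have phi: "norm \<phi> \<le> C1 * norm x"
    proof -
      have "norm \<phi> \<le> C1 * norm (x - P x)"
        using C1(2)[OF f(2)] comp[OF f(3) in_H0[OF f(1)]] by simp
      also have "\<dots> \<le> C1 * norm x" using C1(1) norm_proj_le(2)[OF H0] by (intro mult_left_mono)
      finally show ?thesis .
    qed
    have psi: "norm \<psi> \<le> C2 * norm x"
    proof -
      have "norm \<psi> \<le> C2 * norm (x - P x)"
        using C2(2)[OF f'(2)] comp[OF f'(3) in_H0[OF f'(1)]] by simp
      also have "\<dots> \<le> C2 * norm x" using C2(1) norm_proj_le(2)[OF H0] by (intro mult_left_mono)
      finally show ?thesis .
    qed
    \<comment> \<open>Both sides are the value at \<open>x\<close> of the single-valued
      \<open>dom_adjoint S\<close>.\<close>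
    have "P g + z *\<^sub>C P \<phi> = P g' + cnj z *\<^sub>C P \<psi>"
      using dom_adjoint_unique shtraus_dom_adjoint[OF f(1,2)] shtraus_dom_adjoint[OF f'(1,2)]
        f(3) f'(3) by metis
    then have Pd: "P (g - g') = cnj z *\<^sub>C P \<psi> - z *\<^sub>C P \<phi>"
      by (simp add: P_simps algebra_simps)
    \<comment> \<open>The relative bound is applied to the difference \<open>f - f'\<close>, whose
      shifted value under \<open>S0\<close> involves only \<open>\<phi>\<close> and
      \<open>\<psi>\<close>.\<close>
    have "f - f' = \<psi> - \<phi>" using f(3) f'(3) by (simp add: algebra_simps)
    then have "norm (g - g') \<le> C * norm ((cnj z *\<^sub>C P \<psi> - z *\<^sub>C P \<phi>) - z *\<^sub>C (\<psi> - \<phi>))"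
      using C(2)[OF linear_operator_diff[OF linear_S f(1) f'(1)]] Pd by simp
    also have "\<dots> \<le> C * (2 * cmod z * (norm \<phi> + norm \<psi>))"
    proof (rule mult_left_mono[OF _ C(1)])
      have "norm ((cnj z *\<^sub>C P \<psi> - z *\<^sub>C P \<phi>) - z *\<^sub>C (\<psi> - \<phi>))
          \<le> norm (cnj z *\<^sub>C P \<psi>) + norm (z *\<^sub>C P \<phi>) + norm (z *\<^sub>C (\<psi> - \<phi>))"
        by (meson add_right_mono norm_triangle_ineq4 order_trans)
      also have "\<dots> \<le> cmod z * norm \<psi> + cmod z * norm \<phi> + cmod z * (norm \<psi> + norm \<phi>)"
        using norm_proj_le(1)[OF H0] norm_triangle_ineq4[of \<psi> \<phi>]
        by (intro add_mono) (auto simp: norm_scaleC intro: mult_left_mono)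
      finally show "norm ((cnj z *\<^sub>C P \<psi> - z *\<^sub>C P \<phi>) - z *\<^sub>C (\<psi> - \<phi>))
          \<le> 2 * cmod z * (norm \<phi> + norm \<psi>)"
        by (simp add: algebra_simps)
    qed
    finally have gg: "norm (g - g') \<le> C * (2 * cmod z * (norm \<phi> + norm \<psi>))" .
    have "norm (y - y') \<le> norm (g - g') + cmod z * (norm \<phi> + norm \<psi>)"
    proof -
      have "y - y' = (g - g') + (z *\<^sub>C \<phi> - cnj z *\<^sub>C \<psi>)" using f(4) f'(4) by simp
      then have "norm (y - y') \<le> norm (g - g') + norm (z *\<^sub>C \<phi> - cnj z *\<^sub>C \<psi>)"
        by (simp add: norm_triangle_ineq)
      also have "norm (z *\<^sub>C \<phi> - cnj z *\<^sub>C \<psi>) \<le> cmod z * (norm \<phi> + norm \<psi>)"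
        using norm_triangle_ineq4[of "z *\<^sub>C \<phi>" "cnj z *\<^sub>C \<psi>"]
        by (simp add: norm_scaleC distrib_left)
      finally show ?thesis by simp
    qed
    also have "\<dots> \<le> (2 * C + 1) * cmod z * (norm \<phi> + norm \<psi>)"
      using gg by (simp add: algebra_simps)
    also have "\<dots> \<le> (2 * C + 1) * cmod z * (C1 * norm x + C2 * norm x)"
      using phi psi C(1) by (intro mult_left_mono add_mono) auto
    also have "\<dots> = M * norm x" by (simp add: M_def algebra_simps)
    finally show ?thesis .
  qed
  have "bounded_operator (op_minus (shtraus S z) (shtraus S (cnj z)))"
    unfolding bounded_operator_def
    by (intro conjI linear_op_minus linear_shtraus z z' exI[of _ M])
      (auto simp: op_minus_def bound)
  then show "mutually_adjoint (shtraus S z) (shtraus S (cnj z))"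
    unfolding mutually_adjoint_def
    using linear_shtraus z z' adjoint_shtraus[OF closed_S symmetric_S] zS zS' D D' dense by simp
qed

end

text \<open>\<open>u\<close> and \<open>v\<close> are the points at which the two semi-deficiency
  indices are evaluated. In the claims with strict inclusions, \<open>Im z > 0\<close> fixes the
  orientation: passing to \<open>cnj z\<close> exchanges the extension and its adjoint, and at real
  \<open>z\<close> the two coincide.\<close>

theorem proposition10p1:
  fixes S :: "('a::complex_hilbert \<times> 'a) set"
    and z u v :: complex
  assumes separable: "\<exists>D::'a set. countable D \<and> closure D = UNIV"
    and infinite_dimensional: "hdim (UNIV :: 'a set) = \<infinity>"
    and regular: "regular_symmetric S"
    and z: "z \<in> regular_type_points S"
    and upper: "Im u > 0"
    and lower: "Im v < 0"
  shows
    "(z \<in> regular_type_points (compressed S) \<longrightarrow>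
        closed_operator (op_proj (dom_space S) (shtraus S z)))
     \<and> op_restrict (op_proj (dom_space S) (shtraus S z))
          (Domain (shtraus S z) \<inter> dom_space S)
        = shtraus_compressed S z
     \<and> (Im z > 0 \<and> semi_deficiency_index S u = 0 \<and> semi_deficiency_index S v > 0 \<longrightarrow>
        Domain (shtraus S z) \<subset> Domain (adjoint_op (shtraus S z)) \<and>
        Domain (adjoint_op (shtraus S z)) = Domain (dom_adjoint S))
     \<and> (Im z > 0 \<and> semi_deficiency_index S u > 0 \<and> semi_deficiency_index S v = 0 \<longrightarrow>
        Domain (adjoint_op (shtraus S z)) \<subset> Domain (shtraus S z) \<and>
        Domain (shtraus S z) = Domain (dom_adjoint S))
     \<and> (z \<in> regular_type_points (compressed S) \<and>
          selfadjoint_in (dom_space S) (compressed S) \<longrightarrow>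
        Domain (shtraus S z) = Domain (adjoint_op (shtraus S z)) \<and>
        Domain (adjoint_op (shtraus S z)) = Domain (dom_adjoint S) \<and>
        selfadjoint_in UNIV
          (op_scale (1 / 2) (op_plus (shtraus S z) (adjoint_op (shtraus S z)))) \<and>
        bounded_operator
          (op_scale (1 / (2 * \<i>)) (op_minus (shtraus S z) (adjoint_op (shtraus S z)))) \<and>
        essentially_selfadjoint_in UNIV
          (op_scale (1 / (2 * \<i>)) (op_minus (shtraus S z) (adjoint_op (shtraus S z)))))"
proof -
  interpret regular_symmetric_operator S by unfold_locales (rule regular)
  have adj: "adjoint_op (shtraus S z) = shtraus S (cnj z)"
    by (rule adjoint_shtraus[OF closed_S symmetric_S z])
  have index: "semi_deficiency_index S a = 0 \<longleftrightarrow> semi_defect S a = {0}" for a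
    unfolding semi_deficiency_index_def by (rule hdim_eq_0_iff[OF csubspace_semi_defect])
  have half_plane: "semi_defect S a = {0} \<longleftrightarrow> semi_defect S b = {0}" if "Im a * Im b > 0" for a b
    using semi_defect_trivial_half_plane[of a b] semi_defect_trivial_half_plane[of b a] that
    by (auto simp: mult.commute)
  have nonreal: "z \<in> regular_type_points S0" "cnj z \<in> regular_type_points S0" if "Im z > 0"
    using that nonreal_regular_type[OF symmetric_S0] by auto
  have indices: "semi_defect S z = {0} \<longleftrightarrow> semi_deficiency_index S u = 0"
    "semi_defect S (cnj z) = {0} \<longleftrightarrow> semi_deficiency_index S v = 0" if "Im z > 0"
    using that upper lower half_plane[of u z] half_plane[of v "cnj z"]
    by (auto simp: index mult_neg_pos)
  have part3: "Domain (shtraus S z) \<subset> Domain (dom_adjoint S) \<and>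
      Domain (shtraus S (cnj z)) = Domain (dom_adjoint S)"
    if "Im z > 0 \<and> semi_deficiency_index S u = 0 \<and> semi_deficiency_index S v > 0"
    using that indices nonreal Domain_shtraus_psubset[of z] Domain_shtraus_eq[of z] by simp
  have part4: "Domain (shtraus S (cnj z)) \<subset> Domain (dom_adjoint S) \<and>
      Domain (shtraus S z) = Domain (dom_adjoint S)"
    if "Im z > 0 \<and> semi_deficiency_index S u > 0 \<and> semi_deficiency_index S v = 0"
    using that indices nonreal Domain_shtraus_psubset[of "cnj z"] Domain_shtraus_eq[of "cnj z"]
    by simp
  have part5: "Domain (shtraus S z) = Domain (shtraus S (cnj z)) \<and>
      Domain (shtraus S (cnj z)) = Domain (dom_adjoint S) \<and>
      selfadjoint_in UNIV (op_scale (1 / 2) (op_plus (shtraus S z) (shtraus S (cnj z)))) \<and>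
      bounded_operator (op_scale (1 / (2 * \<i>)) (op_minus (shtraus S z) (shtraus S (cnj z)))) \<and>
      essentially_selfadjoint_in UNIV
        (op_scale (1 / (2 * \<i>)) (op_minus (shtraus S z) (shtraus S (cnj z))))"
    if h: "z \<in> regular_type_points S0 \<and> selfadjoint_in H0 S0"
  proof -
    interpret T: mutually_adjoint "shtraus S z" "shtraus S (cnj z)"
      using mutually_adjoint_shtraus(1) z h by blast
    show ?thesis
      using T.dom mutually_adjoint_shtraus(2)[OF z] h T.re_part_selfadjoint T.bounded_im_part
        T.im_part_essentially_selfadjoint
      unfolding T.re_part_def T.im_part_def by simp
  qed
  show ?thesis
    unfolding adj using closed_proj_shtraus compression_shtraus part3 part4 part5 by simp
qed

end
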